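(* Let $m\ge 5$ be an odd integer. For each of the following trinomials $f$ over $\mathbb{F}_{2^m}$, the binary linear code $\mathcal{C}_{D(f)^*}$ is a $[2^{m-1},\,m,\,2^{m-2}-2^{(m-3)/2}]$-code with weight enumerator polynomial $$1+(2^{m-2}-2^{(m-3)/2})z^{2^{m-2}-2^{(m-3)/2}}+(2^{m-1}-1)z^{2^{m-2}}+(2^{m-2}+2^{(m-3)/2})z^{2^{m-2}+2^{(m-3)/2}},$$ and the dual code of $\mathcal{C}_{D(f)^*}$ is a $[2^{m-1},\,2^{m-1}-m,\,3]$-code: (c) $f_3(x)=x^{2^m-3}+x^{2^{(m+3)/2}+2^{(m+1)/2}+4}+x$; (d) $f_4(x)=x^{2^m-2^{(m-1)/2}-1}+x^{2^{m-1}-2^{(m-1)/2}}+x$; (e) $f_5(x)=x^{2^m-2-(2^{m-1}-2^2)/3}+x^{2^m-2^2-(2^m-2^3)/3}+x$; (f) $f_6(x)=x^{2^m-2^{(m+1)/2}+2^{(m-1)/2}}+x^{2^m-2^{(m+1)/2}-1}+x$; (g) $f_7(x)=x^{2^m-3(2^{(m+1)/2}-1)}+x^{2^{(m+1)/2}+2^{(m-1)/2}-2}+x$; (h) $f_8(x)=x^{2^m-2^{m-2}-1}+x^{2^{m-1}-2}+x$; (i) $f_9(x)=x^{2^m-2^{(m+3)/2}-3}+x^{2^{(m+1)/2}+2}+x$; (j) $f_{10}(x)=x^{2^m-3(2^{(m-1)/2}+1)}+x^{2^{m-1}-1}+x$; (k) $f_{11}(x)=x^{2^m-5}+x^6+x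$.
   Context: For a polynomial $f$ over $\mathbb{F}_{2^m}$, $D(f)^*=\{f(x):x\in\mathbb{F}_{2^m}\}\setminus\{0\}$. $\mathrm{Tr}$ is the absolute trace $\mathbb{F}_{2^m}\to\mathbb{F}_2$. For a subset $D=\{d_1,\dots,d_n\}\subseteq\mathbb{F}_{2^m}$ with $n$ elements, $\mathcal{C}_D=\{(\mathrm{Tr}(xd_1),\dots,\mathrm{Tr}(xd_n)):x\in\mathbb{F}_{2^m}\}\subseteq\mathbb{F}_2^n$ (the ordering of $D$ is immaterial for the statement). A binary linear $[n,k,d]$-code is a $k$-dimensional subspace of $\mathbb{F}_2^n$ whose nonzero codewords have minimum Hamming weight $d$. The weight enumerator polynomial of a code $\mathcal{C}$ of length $n$ is $1+A_1z+\cdots+A_nz^n$, where $A_i$ is the number of codewords of Hamming weight $i$. The dual code is $\mathcal{C}^\perp=\{u\in\mathbb{F}_2^n: u\cdot c=0\text{ for all }c\in\mathcal{C}\}$. *)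

theory Defs
  imports
    "Jordan_Normal_Form.VS_Connect"
    "HOL-Computational_Algebra.Polynomial"
    "HOL-Computational_Algebra.Primes"
    "HOL-Library.Cardinality"
    "HOL-Library.Z2"
begin

(* The elements of F_2 are those of the library type bit; of_bit embeds them into any field.
   The sum below is formed in the field 'a and lies in the image of of_bit
   when 'a has 2^m elements; see of_bit_abs_trace. *)
definition abs_trace :: "nat \<Rightarrow> 'a::finite_field \<Rightarrow> bit" where
  "abs_trace m x = (THE b. of_bit b = (\<Sum>i<m. x ^ (2 ^ i)))"

lemma of_bit_abs_trace:
  fixes x :: "'a::finite_field"
  assumes "CARD('a) = 2 ^ m"
  shows "of_bit (abs_trace m x) = (\<Sum>i<m. x ^ (2 ^ i))"
proof -
  let ?s = "\<Sum>i<m. x ^ (2 ^ i)"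
  have "prime CHAR('a)" by (rule prime_CHAR_semidom[OF finite_imp_CHAR_pos]) simp
  moreover have "CHAR('a) dvd 2 ^ m"
  proof -
    have "(of_nat (card (UNIV :: 'a set)) :: 'a) = 0"
    proof -
      have "(\<Sum>y\<in>UNIV. y) = (\<Sum>y\<in>UNIV. y + (1::'a))"
        by (rule sum.reindex_bij_witness[of _ "\<lambda>y. y + 1" "\<lambda>y. y - 1"]) auto
      then show ?thesis by (simp add: sum.distrib)
    qed
    then show ?thesis unfolding assms by (simp only: of_nat_eq_0_iff_char_dvd)
  qed
  ultimately have "CHAR('a) dvd 2" by (rule prime_dvd_power)
  with \<open>prime CHAR('a)\<close> have char2: "CHAR('a) = 2"
    by (intro primes_dvd_imp_eq two_is_prime_nat)
  have "?s ^ 2 = (\<Sum>i<m. (x ^ (2 ^ i)) ^ 2)"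
    by (rule freshmans_dream_sum) (fact \<open>prime CHAR('a)\<close> char2[symmetric])+
  also have "\<dots> = (\<Sum>i<m. x ^ (2 ^ Suc i))"
    by (simp only: power_mult[symmetric] power_Suc2)
  also have "\<dots> = (\<Sum>i<Suc m. x ^ (2 ^ i)) - x"
    by (subst sum.lessThan_Suc_shift) simp
  also have "\<dots> = ?s"
    using finite_field_power_card_eq_same[of x] assms by simp
  finally have "?s * (?s - 1) = 0" by (simp add: algebra_simps power2_eq_square)
  then have "?s = of_bit 0 \<or> ?s = of_bit 1" by simp
  moreover have "b = c" if "of_bit b = (of_bit c :: 'a)" for b c
    using that by (cases b; cases c) auto
  ultimately have "\<exists>!b. of_bit b = ?s" by (elim disjE) (rule ex1I, erule sym, simp)+
  then show ?thesis unfolding abs_trace_def by (rule theI')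
qed

definition nonzero_values :: "'a::field poly \<Rightarrow> 'a set" where
  "nonzero_values f = range (poly f) - {0}"

(* The list ds enumerates the defining set and fixes the order of the coordinates. *)
definition trace_code :: "nat \<Rightarrow> 'a::finite_field list \<Rightarrow> bit vec set" where
  "trace_code m ds = range (\<lambda>x. vec_of_list (map (\<lambda>d. abs_trace m (x * d)) ds))"

definition hamming_weight :: "bit vec \<Rightarrow> nat" where
  "hamming_weight v = card {i. i < dim_vec v \<and> v $ i \<noteq> 0}"

definition linear_code :: "nat \<Rightarrow> nat \<Rightarrow> nat \<Rightarrow> bit vec set \<Rightarrow> bool" where
  "linear_code n k d C \<longleftrightarrow>
     VectorSpace.subspace class_ring C (module_vec TYPE(bit) n) \<and>
     vectorspace.dim class_ring (module_vec TYPE(bit) n\<lparr>carrier := C\<rparr>) = k \<and>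
     (\<exists>c\<in>C - {0\<^sub>v n}. hamming_weight c = d) \<and>
     (\<forall>c\<in>C - {0\<^sub>v n}. d \<le> hamming_weight c)"

definition weight_enumerator :: "nat \<Rightarrow> bit vec set \<Rightarrow> int poly" where
  "weight_enumerator n C =
     1 + (\<Sum>i=1..n. monom (int (card {c \<in> C. hamming_weight c = i})) i)"

definition dual_code :: "nat \<Rightarrow> bit vec set \<Rightarrow> bit vec set" where
  "dual_code n C = {u \<in> carrier_vec n. \<forall>c\<in>C. u \<bullet> c = 0}"

end

theory Submission
  imports Defs
begin

text \<open>
Let \<open>q = 2 ^ m\<close>, let \<open>Tr\<close> be the absolute trace and \<open>chi = (-1) ^ Tr\<close> the canonical additive
character, and let \<open>bar x = x ^ \<sigma>\<close> with \<open>\<sigma> = 2 ^ ((m + 1) div 2)\<close>, so that \<open>bar (bar x) = x\<^sup>2\<close>. A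
nonzero codeword of the trace code of a set \<open>D\<close> has weight \<open>(card D - W) / 2\<close>, where \<open>W\<close> is the sum
of \<open>chi (a * y)\<close> over \<open>y \<in> D\<close>. The whole statement therefore follows from a property of the
set of nonzero values of the trinomial, called \<open>semibent_set\<close> below: it consists of
\<open>2 ^ (m - 1)\<close> nonzero elements, and \<open>W\<^sup>2 \<in> {0, 2 ^ (m - 1)}\<close> for every \<open>a \<noteq> 0\<close>. The first two power
moments of \<open>W\<close> then give the weight distribution, the third moment produces three elements of
\<open>D\<close> with sum \<open>0\<close> and hence a dual word of weight 3, and smaller dual weights are impossible
because the elements of \<open>D\<close> are distinct and nonzero (\<open>code_parameters\<close>).

On nonzero elements exponents only matter modulo \<open>q - 1\<close>. Up to a substitution \<open>x \<mapsto> x ^ c\<close> with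
\<open>c\<close> invertible modulo \<open>q - 1\<close>, and up to a power of the Frobenius automorphism, the nine trinomials
are only three functions: \<open>glynn x = x^-2 + bar x^3 x^4 + x\<close> for (c), (g), (j),
\<open>norm_fun x = x^2 + bar x^-2 + x^2 / bar x\<close> for (d), (f), (i), and
\<open>segre_fun x = x^-4 + x^6 + x\<close> for (e), (h), (k).

The values of the first function are exactly the \<open>y\<close> with \<open>Tr (y ^ 3) = 1\<close>, and those of the
second are the squares of the \<open>y\<close> with \<open>Tr (y * bar y) = 1\<close>. That all values satisfy the trace
condition is an identity in which everything but the constant \<open>1\<close> cancels in pairs of equal trace.
That all such \<open>y\<close> occur is proved by an explicit preimage. The trace condition is an equation
\<open>y ^ 3 = v\<^sup>2 + v + 1\<close>, whose right-hand side is the norm of \<open>v + \<omega>\<close> for a root \<open>\<omega>\<close> of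
\<open>X\<^sup>2 + X + 1\<close>; this polynomial is irreducible as \<open>m\<close> is odd. In the coordinate \<open>r\<close> of \<open>r + \<omega>\<close> the map \<open>kappa\<close> describes
multiplication of \<open>r + \<omega>\<close> by \<open>bar r + \<omega>\<close> up to scalars. It is injective because a coincidence would
give an element \<open>d\<close> with \<open>d + bar d + 1 = 0\<close>, although \<open>Tr 1 = 1\<close>. Hence \<open>v = kappa r\<close> for some \<open>r\<close>, and in
terms of \<open>r\<close> the preimage or its cube is a monomial in \<open>r\<^sup>2 + r + 1\<close>, \<open>r + bar r + 1\<close> and their images under
\<open>bar\<close>. Both value sets are semibent because \<open>Tr (y ^ 3)\<close> and \<open>Tr (y * bar y)\<close> are quadratic forms
whose radicals have two elements.

The values of the third function are the complement of the values of Segre's two-to-one map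
\<open>r \<mapsto> r ^ 6 + r\<close>. The two value sets are disjoint by a trace argument. The first has \<open>2 ^ (m - 1)\<close>
elements because \<open>segre_fun\<close> is injective on the elements \<open>x\<close> with \<open>Tr (x ^ 5) = 1\<close>, while every other
nonzero \<open>x\<close> shares its value with such an element. The second has at least as many, because its
fibres have at most two elements; so both have half the size of the field. The
character sums of the complement are again those of quadratic forms, this time
\<open>Tr (a * (r ^ 6 + r))\<close>.
\<close>

section \<open>Binary fields of odd degree\<close>

lemma of_bit_eq_iff: "of_bit b = (of_bit c :: 'a::zero_neq_one) \<longleftrightarrow> b = c"
  by (cases b; cases c) auto

locale odd_binary_field =
  fixes m :: nat and field_type :: "'a::finite_field itself"
  assumes card_field: "CARD('a) = 2 ^ m"
    and odd_m: "odd m"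
begin

lemma two_eq_zero: "(2::'a) = 0"
proof -
  have "(\<Sum>y\<in>UNIV. y) = (\<Sum>y\<in>UNIV. y + (1::'a))"
    by (rule sum.reindex_bij_witness[of _ "\<lambda>y. y + 1" "\<lambda>y. y - 1"]) auto
  then have "(of_nat CARD('a) :: 'a) = 0" by (simp add: sum.distrib)
  then have "(2::'a) ^ m = 0" by (simp add: card_field)
  then show ?thesis by simp
qed

lemma add_self [simp]: "x + x = (0::'a)"
  using two_eq_zero by (metis mult_2 mult_zero_left)

lemma add_self_left [simp]: "x + (x + y) = (y::'a)"
  by (simp flip: add.assoc)

lemma uminus_eq [simp]: "- x = (x::'a)"
  by (simp add: minus_unique)

lemma diff_eq_add [simp]: "x - y = x + (y::'a)"
  by (simp only: diff_conv_add_uminus uminus_eq)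

lemma add_eq_zero_iff [simp]: "x + y = 0 \<longleftrightarrow> x = (y::'a)"
  by (metis add_self add_self_left add.right_neutral)

lemma square_add: "(x + y) ^ 2 = x ^ 2 + (y::'a) ^ 2"
  by (simp add: power2_sum two_eq_zero)

lemma pow2_add: "(x + y) ^ (2 ^ k) = x ^ (2 ^ k) + (y::'a) ^ (2 ^ k)"
  by (induction k) (simp_all only: power_Suc2 power_mult square_add power_0 power_one_right)

lemma power_field_card: "(x::'a) ^ (2 ^ m) = x"
  using finite_field_power_card_eq_same[of x] card_field by simp

subsection \<open>The trace\<close>

abbreviation Tr :: "'a \<Rightarrow> bit" where "Tr \<equiv> abs_trace m"

lemma of_bit_Tr: "of_bit (Tr x) = (\<Sum>i<m. x ^ (2 ^ i))"
  by (rule of_bit_abs_trace) (fact card_field)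

lemma of_bit_add: "of_bit (b + c) = of_bit b + (of_bit c :: 'a)"
  by (cases b; cases c) auto

lemma Tr_add [simp]: "Tr (x + y) = Tr x + Tr y"
proof -
  have "of_bit (Tr (x + y)) = (of_bit (Tr x + Tr y) :: 'a)"
    by (simp only: of_bit_Tr of_bit_add pow2_add sum.distrib)
  then show ?thesis by (simp only: of_bit_eq_iff)
qed

lemma Tr_0 [simp]: "Tr 0 = 0"
  using Tr_add[of 0 0] by (cases "Tr 0") (auto simp del: Tr_add)

lemma Tr_1 [simp]: "Tr 1 = 1"
proof -
  have "of_bit (Tr 1) = (of_nat m :: 'a)" by (simp only: of_bit_Tr power_one) simp
  also have "\<dots> = of_bit 1"
    using odd_m by (auto elim!: oddE simp: two_eq_zero)
  finally show ?thesis by (simp only: of_bit_eq_iff)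
qed

lemma Tr_square [simp]: "Tr (x ^ 2) = Tr x"
proof -
  have "of_bit (Tr (x ^ 2)) = (\<Sum>i<m. x ^ (2 ^ Suc i))"
    by (simp only: of_bit_Tr power_mult[symmetric] power_Suc)
  also have "\<dots> = (\<Sum>i<Suc m. x ^ (2 ^ i)) + x"
    by (subst sum.lessThan_Suc_shift) (simp add: add.commute add.left_commute)
  also have "\<dots> = (of_bit (Tr x) :: 'a)"
    by (simp only: of_bit_Tr sum.lessThan_Suc power_field_card add.assoc add_self add_0_right)
  finally show ?thesis by (simp only: of_bit_eq_iff)
qed

lemma Tr_pow2: "Tr (x ^ (2 ^ k)) = Tr x"
  by (induction k) (simp_all only: power_Suc2 power_mult Tr_square power_0 power_one_right)

lemma bit_add_self [simp]: "b + b = (0::bit)"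
  by (cases b) auto

definition chi :: "'a \<Rightarrow> int" where
  "chi x = (if Tr x = 0 then 1 else - 1)"

lemma chi_add: "chi (x + y) = chi x * chi y"
  by (cases "Tr x"; cases "Tr y") (auto simp: chi_def)

lemma chi_mult_self [simp]: "chi x * chi x = 1"
  by (simp add: chi_def)

lemma chi_square [simp]: "chi (x ^ 2) = chi x"
  by (simp add: chi_def)

lemma chi_0 [simp]: "chi 0 = 1"
  by (simp add: chi_def)

lemma sum_chi_eq_0: "(\<Sum>x\<in>UNIV. chi x) = 0"
proof -
  have "(\<Sum>x\<in>UNIV. chi x) = (\<Sum>x\<in>UNIV. chi (x + 1))"
    by (rule sum.reindex_bij_witness[of _ "\<lambda>y. y + 1" "\<lambda>y. y + 1"]) (auto simp: add.assoc)
  also have "\<dots> = - (\<Sum>x\<in>UNIV. chi x)"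
    by (simp add: chi_add sum_negf chi_def[of 1])
  finally show ?thesis by simp
qed

lemma sum_chi_bij:
  assumes "inj (g :: 'a \<Rightarrow> 'a)"
  shows "(\<Sum>x\<in>UNIV. chi (g x)) = 0"
proof -
  have "bij g" using assms finite_UNIV_inj_surj[OF finite_class.finite_UNIV] by (auto simp: bij_def)
  then show ?thesis
    using sum.reindex_bij_betw[of g UNIV UNIV chi] sum_chi_eq_0 by simp
qed

lemma sum_chi_mult: "(\<Sum>x\<in>UNIV. chi (x * c)) = (if c = 0 then 2 ^ m else 0)"
proof (cases "c = 0")
  case False
  then have "inj (\<lambda>x. x * c)" by (auto simp: inj_on_def)
  then show ?thesis using sum_chi_bij[of "\<lambda>x. x * c"] False by simp
qed (simp add: card_field)

lemma card_Tr_fibres: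
  "card {x. Tr x = 0} = 2 ^ (m - 1)" "card {x. Tr x = 1} = 2 ^ (m - 1)"
proof -
  have m: "m = Suc (m - 1)" using odd_m by (cases m) auto
  have Tr_compl: "- {x. Tr x = 0} = {x. Tr x = 1}" by auto
  have "(\<Sum>x\<in>UNIV. chi x) = int (card {x. Tr x = 0}) - int (card (- {x. Tr x = 0}))"
    by (simp only: chi_def sum.If_cases[OF finite_class.finite_UNIV])
     simp
  then have "int (card {x. Tr x = 0}) = int (card {x. Tr x = 1})"
    by (simp only: Tr_compl sum_chi_eq_0)
  moreover have "card {x. Tr x = 0} + card {x. Tr x = 1} = 2 ^ m"
  proof -
    have "card ({x. Tr x = 0} \<union> {x. Tr x = 1}) = card {x. Tr x = 0} + card {x. Tr x = 1}"
      by (rule card_Un_disjoint) auto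
    moreover have "{x. Tr x = 0} \<union> {x. Tr x = 1} = UNIV" by auto
    ultimately show ?thesis by (simp add: card_field)
  qed
  ultimately show "card {x. Tr x = 0} = 2 ^ (m - 1)" "card {x. Tr x = 1} = 2 ^ (m - 1)"
    using m by (metis int_ops(1) mult_2 nat_mult_eq_cancel_disj power_Suc of_nat_eq_iff zero_neq_numeral)+
qed

text \<open>Counting shows that nothing but the trace obstructs solvability: \<open>v \<mapsto> v\<^sup>2 + v\<close> is two-to-one and its values have trace
\<open>0\<close>, and there are exactly \<open>2 ^ (m - 1)\<close> elements of trace \<open>0\<close>.\<close>

lemma artin_schreier:
  assumes "Tr x = 0"
  obtains v where "x = v ^ 2 + v"
proof -
  let ?g = "\<lambda>v::'a. v ^ 2 + v"
  have fibre: "{v. ?g v = ?g w} = {w, w + 1}" for w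
  proof -
    have "?g v = ?g w \<longleftrightarrow> (v + w) * (v + w + 1) = 0" for v
    proof -
      have "(v + w) * (v + w + 1) = ?g v + ?g w"
        by (simp add: algebra_simps power2_eq_square)
      then show ?thesis by (metis add_eq_zero_iff)
    qed
    moreover have "v + w + 1 = 0 \<longleftrightarrow> v = w + 1" for v
      by (metis add.assoc add_eq_zero_iff)
    ultimately show ?thesis by auto
  qed
  have "card (UNIV :: 'a set) = (\<Sum>y\<in>range ?g. card {v. ?g v = y})"
    by (simp only: card_eq_sum sum.image_gen[of UNIV "\<lambda>_. 1" ?g, OF finite_class.finite_UNIV] UNIV_I simp_thms)
  also have "\<dots> = (\<Sum>y\<in>range ?g. 2)"
  proof (rule sum.cong[OF refl])
    fix y assume "y \<in> range ?g"
    then obtain w where "y = ?g w" by blast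
    then show "card {v. ?g v = y} = 2" by (simp only: fibre) simp
  qed
  finally have "2 * card (range ?g) = 2 * 2 ^ (m - 1)"
    using odd_m by (cases m) (auto simp: card_field)
  then have "card (range ?g) = card {x. Tr x = 0}" by (simp add: card_Tr_fibres)
  moreover have "range ?g \<subseteq> {x. Tr x = 0}" by auto
  ultimately have "range ?g = {x. Tr x = 0}" by (metis card_subset_eq finite)
  then show ?thesis using assms that by blast
qed

text \<open>The degree is odd, so \<open>Tr 1 = 1\<close>, whereas \<open>v\<^sup>2 + v\<close> has trace \<open>0\<close>. A
root \<open>\<omega>\<close> of \<open>X\<^sup>2 + X + 1\<close> therefore generates the quadratic extension of the field.\<close>

lemma quadratic_nonzero: "v ^ 2 + v + 1 \<noteq> (0::'a)"
proof
  assume "v ^ 2 + v + 1 = 0"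
  then have "Tr (v ^ 2 + v + 1) = 0" by (simp only: Tr_0)
  then show False by simp
qed

lemma cube_eq_iff: "x ^ 3 = y ^ 3 \<longleftrightarrow> x = (y::'a)"
proof
  assume eq: "x ^ 3 = y ^ 3"
  show "x = y"
  proof (cases "y = 0")
    case False
    define u where "u = x / y"
    have "u ^ 3 = 1" using eq False by (simp add: u_def power_divide)
    then have "(u + 1) * (u ^ 2 + u + 1) = 0"
      by (simp add: algebra_simps power2_eq_square power3_eq_cube)
    then have "u = 1" using quadratic_nonzero by simp
    then show ?thesis using False by (simp add: u_def)
  qed (use eq in simp)
qed simp

text \<open>A nontrivial fifth root of unity \<open>u\<close> would make \<open>u + 1 / u\<close> a root of \<open>X\<^sup>2 + X + 1\<close>.\<close>

lemma inj_fifth_power: "inj (\<lambda>x::'a. x ^ 5)"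
proof (rule injI)
  fix x y :: 'a
  assume eq: "x ^ 5 = y ^ 5"
  show "x = y"
  proof (cases "y = 0")
    case False
    define u where "u = x / y"
    have "u ^ 5 = 1" using eq False by (simp add: u_def power_divide)
    moreover from this have u: "u \<noteq> 0" by auto
    have "u ^ 5 = 1 + u ^ 2 * (u + 1) * ((u + 1 / u) ^ 2 + (u + 1 / u) + 1)"
      using u by (simp add: field_simps) (simp add: algebra_simps power2_eq_square eval_nat_numeral)
    ultimately have "u ^ 2 * (u + 1) * ((u + 1 / u) ^ 2 + (u + 1 / u) + 1) = 0"
      by (metis add_cancel_left_right)
    then have "u = 1" using quadratic_nonzero u by simp
    then show ?thesis using False by (simp add: u_def)
  qed (use eq in simp)
qed

lemma inj_imp_surj: "inj g \<Longrightarrow> surj (g :: 'a \<Rightarrow> 'a)"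
  by (rule finite_UNIV_inj_surj) auto

lemma eq_add_if_add_eq: "x + y = z \<Longrightarrow> x = z + (y::'a)"
  by (metis add.assoc add_self add_0_right)

lemma surj_cube: "surj (\<lambda>x::'a. x ^ 3)"
  by (rule inj_imp_surj) (simp add: inj_def cube_eq_iff)

subsection \<open>The square root of Frobenius\<close>

text \<open>As \<open>m\<close> is odd, \<open>m + 1\<close> is even and the Frobenius automorphism has a square root in the Galois
group.\<close>

definition bar :: "'a \<Rightarrow> 'a" where
  "bar x = x ^ (2 ^ ((m + 1) div 2))"

lemma bar_add [simp]: "bar (x + y) = bar x + bar y"
  by (simp add: bar_def pow2_add)
lemma bar_mult [simp]: "bar (x * y) = bar x * bar y"
  by (simp add: bar_def power_mult_distrib)
lemma bar_divide [simp]: "bar (x / y) = bar x / bar y"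
  by (simp add: bar_def power_divide)
lemma bar_power [simp]: "bar (x ^ k) = bar x ^ k"
  by (simp add: bar_def power_mult[symmetric] mult.commute)
lemma bar_1 [simp]: "bar 1 = 1" by (simp add: bar_def)
lemma bar_eq_0_iff [simp]: "bar x = 0 \<longleftrightarrow> x = 0" by (simp add: bar_def)
lemma Tr_bar [simp]: "Tr (bar x) = Tr x" by (simp add: bar_def Tr_pow2)

lemma bar_bar [simp]: "bar (bar x) = x ^ 2"
proof -
  obtain j where m: "m = 2 * j + 1" using odd_m by (auto elim: oddE)
  have "bar (bar x) = x ^ (2 ^ (m + 1))"
    unfolding bar_def power_mult[symmetric] power_add[symmetric]
    by (simp add: m mult_2)
  also have "\<dots> = (x ^ (2 ^ m)) ^ 2" by (simp flip: power_mult add: mult.commute)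
  finally show ?thesis by (simp add: power_field_card)
qed

lemma bar_inj: "bar x = bar y \<longleftrightarrow> x = y"
  by (metis add_eq_zero_iff bar_add bar_eq_0_iff)

lemma bar_surj: obtains u where "x = bar u"
  using inj_imp_surj[of bar] by (metis bar_inj injI surjD)

text \<open>On exponents, \<open>(\<sigma> + 1) * (\<sigma> - 1) = \<sigma>\<^sup>2 - 1\<close>, which is \<open>1\<close> because \<open>\<sigma>\<^sup>2\<close> acts as \<open>2\<close>.\<close>

lemma mult_bar_inj: "inj (\<lambda>x. x * bar x)"
proof (rule injI)
  have inv: "x = bar (x * bar x) / (x * bar x)" for x
    by (cases "x = 0") (simp_all add: power2_eq_square)
  show "x = y" if "x * bar x = y * bar y" for x y
    using inv[of x] inv[of y] that by simp
qed

lemma trace_denominator_nonzero: "r + bar r + 1 \<noteq> 0"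
proof
  assume "r + bar r + 1 = 0"
  then have "Tr (r + bar r + 1) = 0" by (simp only: Tr_0)
  then show False by simp
qed

section \<open>Value sets given by trace conditions\<close>

text \<open>Let \<open>\<omega>\<^sup>2 + \<omega> + 1 = 0\<close>. Then \<open>(r + \<omega>) * (bar r + \<omega>) = (r * bar r + 1) + \<omega> * (r + bar r + 1)\<close>, so
\<open>kappa r + \<omega>\<close> is this product up to a factor in the field. In other words, \<open>kappa\<close> is
the power map \<open>R \<mapsto> R * R ^ \<tau>\<close>, with \<open>\<tau>\<close> the extension of \<open>bar\<close> that fixes \<open>\<omega>\<close>, on the quotient of the
multiplicative groups of the quadratic extension and of the field, in the coordinate \<open>r\<close> of \<open>R = r + \<omega>\<close>.\<close>

definition kappa :: "'a \<Rightarrow> 'a" where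
  "kappa r = (r * bar r + 1) / (r + bar r + 1)"

text \<open>Injectivity suffices. If \<open>kappa s = kappa t\<close>, the quotient of \<open>s + \<omega>\<close> and \<open>t + \<omega>\<close> lies in the kernel of
the power map. Its coordinate is \<open>d = (s * t + s + 1) / (s + t)\<close>, and lying in the kernel means that the
\<open>\<omega>\<close>-component \<open>d + bar d + 1\<close> of the product vanishes, which the trace forbids.\<close>

lemma kappa_surj: obtains r where "kappa r = v"
proof -
  have clear_denominators: "(n / p + l / q + 1) * (p * q) = n * q + l * p + p * q"
    if "p \<noteq> 0" "q \<noteq> 0" for n l p q :: 'a
    using that by (simp add: distrib_right)
  have "inj kappa"
  proof (rule injI, rule ccontr)
    fix s t
    assume eq: "kappa s = kappa t" and ne: "s \<noteq> t"
    define d where "d = (s * t + s + 1) / (s + t)"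
    have "s + t \<noteq> 0" "bar s + bar t \<noteq> 0" using ne by (simp_all add: bar_inj)
    have "(s * bar s + 1) * (t + bar t + 1) = (t * bar t + 1) * (s + bar s + 1)"
      using eq trace_denominator_nonzero[of s] trace_denominator_nonzero[of t]
      by (simp add: kappa_def frac_eq_eq)
    moreover have "(s * t + s + 1) * (bar s + bar t) + (bar s * bar t + bar s + 1) * (s + t)
        + (s + t) * (bar s + bar t)
        = (s * bar s + 1) * (t + bar t + 1) + (t * bar t + 1) * (s + bar s + 1)"
      by (simp add: algebra_simps)
    ultimately have "(s * t + s + 1) * (bar s + bar t) + (bar s * bar t + bar s + 1) * (s + t)
        + (s + t) * (bar s + bar t) = 0"
      by (simp only: add_self)
    then have "(d + bar d + 1) * ((s + t) * (bar s + bar t)) = 0"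
      using clear_denominators[of "s + t" "bar s + bar t"] ne
      by (simp only: d_def bar_divide bar_add bar_mult bar_1 \<open>s + t \<noteq> 0\<close> \<open>bar s + bar t \<noteq> 0\<close> simp_thms)
    then show False using trace_denominator_nonzero[of d] ne
      by (simp only: mult_eq_0_iff \<open>s + t \<noteq> 0\<close> \<open>bar s + bar t \<noteq> 0\<close> simp_thms)
  qed
  then show ?thesis using inj_imp_surj that by (metis surjD)
qed

text \<open>Multiplicativity of the norm \<open>a + \<omega> * b \<mapsto> a\<^sup>2 + a * b + b\<^sup>2\<close>.\<close>

lemma quadratic_kappa:
  "kappa r ^ 2 + kappa r + 1 =
    (r ^ 2 + r + 1) * (bar r ^ 2 + bar r + 1) / (r + bar r + 1) ^ 2"
proof -
  have "(r * s + 1) ^ 2 + (r * s + 1) * (r + s + 1) + (r + s + 1) ^ 2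
      = (r ^ 2 + r + 1) * (s ^ 2 + s + 1)" for s
    by (simp add: eval_nat_numeral algebra_simps)
  from this[of "bar r"] show ?thesis
    using trace_denominator_nonzero[of r]
    by (simp add: kappa_def power_divide divide_simps)
      (simp add: power2_eq_square algebra_simps)
qed

lemma cube_sum3:
  "(a + b + c) ^ 3 = a ^ 3 + b ^ 3 + c ^ 3 + a ^ 2 * b + a ^ 2 * c + b ^ 2 * a + b ^ 2 * c
    + c ^ 2 * a + c ^ 2 * (b::'a)"
  by (simp add: eval_nat_numeral algebra_simps)

text \<open>The exponent \<open>3 * \<sigma> + 4\<close> of the middle term is that of Glynn's o-monomial.\<close>

definition glynn :: "'a \<Rightarrow> 'a" where
  "glynn x = 1 / x ^ 2 + bar x ^ 3 * x ^ 4 + x"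

text \<open>Of the nine terms of the cube one is \<open>1\<close>. The other eight form four pairs of equal trace, namely a
term and its image under \<open>bar\<close>, where the pair \<open>x^-3\<close>, \<open>x^-6\<close> needs two applications of \<open>bar\<close>.\<close>

lemma Tr_cube_glynn:
  assumes "x \<noteq> 0"
  shows "Tr (glynn x ^ 3) = 1"
proof -
  define i j where "i = 1 / x" and "j = 1 / bar x"
  define a b where "a = i ^ 2" and "b = bar x ^ 3 * x ^ 4"
  define p h where "p = x ^ 9 * bar x ^ 6" and "h = bar x ^ 3 * x ^ 6"
  have ij: "i * x = 1" "bar i = j" "bar j = i ^ 2"
    using assms by (simp_all add: i_def j_def power_divide)
  have "glynn x = a + b + x"
    by (simp add: glynn_def a_def b_def i_def power_divide)
  then have "glynn x ^ 3 = a ^ 3 + b ^ 3 + x ^ 3 + a ^ 2 * b + a ^ 2 * x + b ^ 2 * a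
      + b ^ 2 * x + x ^ 2 * a + x ^ 2 * b"
    by (simp only: cube_sum3)
  moreover have "a ^ 3 = bar j ^ 3" by (simp only: a_def ij)
  moreover have "b ^ 3 = bar p"
    by (simp add: b_def p_def power_mult_distrib flip: power_mult)
  moreover have "a ^ 2 * b = bar x ^ 3 * (i * x) ^ 4" "a ^ 2 * x = i ^ 3 * (i * x)"
      "b ^ 2 * a = bar h * (i * x) ^ 2" "b ^ 2 * x = p" "x ^ 2 * a = (i * x) ^ 2" "x ^ 2 * b = h"
    by (simp_all add: a_def b_def p_def h_def eval_nat_numeral ac_simps)
  ultimately have "glynn x ^ 3 = bar j ^ 3 + bar p + x ^ 3 + bar x ^ 3 + i ^ 3 + bar h + p + 1 + h"
    by (simp add: ij(1))
  also have "\<dots> = 1 + (p + bar p) + (x ^ 3 + bar x ^ 3) + (h + bar h)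
      + ((i ^ 3 + j ^ 3) + bar (i ^ 3 + j ^ 3))"
    by (simp only: bar_add bar_power ij(2)) (simp add: add_ac)
  finally show ?thesis by (simp flip: bar_power)
qed

text \<open>Since \<open>y ^ 3 + 1\<close> has trace \<open>0\<close>, \<open>y ^ 3 = v\<^sup>2 + v + 1\<close> is the norm of \<open>v + \<omega>\<close>, and \<open>v = kappa r\<close> makes it
\<open>\<phi> * \<psi> / \<zeta>\<^sup>2\<close>, in the notation of the proof. Because cubing is bijective, it suffices to find \<open>x ^ 3\<close>, and \<open>glynn x ^ 3\<close>
is a function of \<open>x ^ 3\<close>.\<close>

lemma glynn_surj:
  assumes "Tr (y ^ 3) = 1"
  obtains x where "x \<noteq> 0" "glynn x = y"
proof -
  have "Tr (y ^ 3 + 1) = 0" using assms by simp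
  then obtain v where "y ^ 3 + 1 = v ^ 2 + v" by (rule artin_schreier)
  then have "y ^ 3 = v ^ 2 + v + 1" by (rule eq_add_if_add_eq)
  moreover obtain r where "kappa r = v" by (rule kappa_surj)
  ultimately have y3: "y ^ 3 = kappa r ^ 2 + kappa r + 1" by simp
  define s \<phi> \<psi> \<zeta> where "s = bar r" and "\<phi> = r ^ 2 + r + 1" and "\<psi> = s ^ 2 + s + 1"
    and "\<zeta> = r + s + 1"
  have nz: "\<phi> \<noteq> 0" "\<psi> \<noteq> 0" "\<zeta> \<noteq> 0"
    by (simp_all only: \<phi>_def \<psi>_def \<zeta>_def s_def quadratic_nonzero trace_denominator_nonzero not_False_eq_True)
  have bars: "bar \<phi> = \<psi>" "bar \<psi> = \<phi> ^ 2" "bar \<zeta> = s + r ^ 2 + 1"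
    by (simp_all add: \<phi>_def \<psi>_def \<zeta>_def s_def square_add)
  \<comment> \<open>The only property of this monomial that is used is \<open>1 + x ^ 3 + (x ^ 3)\<^sup>2 * bar x ^ 3 = \<psi> / \<phi>\<close>, shown next.\<close>
  obtain x where x3: "x ^ 3 = \<zeta> * \<psi> / \<phi> ^ 2"
    using surjD[OF surj_cube] by metis
  then have x0: "x \<noteq> 0" using nz by auto
  have bx3: "bar x ^ 3 = (s + r ^ 2 + 1) * \<phi> ^ 2 / \<psi> ^ 2"
    using arg_cong[OF x3, of bar] by (simp add: bars)
  have "\<phi> ^ 2 + \<zeta> * \<psi> + \<zeta> ^ 2 * (s + r ^ 2 + 1) = \<phi> * \<psi>"
    unfolding \<phi>_def \<psi>_def \<zeta>_def by (simp add: eval_nat_numeral algebra_simps)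
  moreover have "1 + x ^ 3 + (x ^ 3) ^ 2 * bar x ^ 3
      = (\<phi> ^ 2 + \<zeta> * \<psi> + \<zeta> ^ 2 * (s + r ^ 2 + 1)) / \<phi> ^ 2"
    unfolding x3 bx3 power_divide power_mult_distrib using nz
    by (simp add: divide_simps) (simp add: eval_nat_numeral algebra_simps)
  ultimately have "1 + x ^ 3 + (x ^ 3) ^ 2 * bar x ^ 3 = \<psi> / \<phi>"
    using nz by (simp add: power2_eq_square)
  moreover have "glynn x * x ^ 2 = 1 + x ^ 3 + (x ^ 3) ^ 2 * bar x ^ 3"
    using x0 by (simp add: glynn_def field_simps eval_nat_numeral)
  ultimately have "(glynn x * x ^ 2) ^ 3 = (\<psi> / \<phi>) ^ 3" by simp
  then have "glynn x ^ 3 * (x ^ 3) ^ 2 = (\<psi> / \<phi>) ^ 3"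
    by (simp add: power_mult_distrib flip: power_mult)
  then have "glynn x ^ 3 = \<phi> * \<psi> / \<zeta> ^ 2"
    unfolding x3 using nz by (simp add: field_simps eval_nat_numeral)
  also have "\<dots> = y ^ 3"
    unfolding y3 quadratic_kappa \<phi>_def \<psi>_def \<zeta>_def s_def by simp
  finally show ?thesis using that x0 by (simp add: cube_eq_iff)
qed

text \<open>The square of the trinomial \<open>x + x ^ (- \<sigma>) + x ^ (1 - \<sigma> / 2)\<close>; squaring avoids the square root of \<open>x\<close>.\<close>

definition norm_fun :: "'a \<Rightarrow> 'a" where
  "norm_fun x = x ^ 2 + 1 / bar x ^ 2 + x ^ 2 / bar x"

text \<open>Multiplying by the conjugate makes the function depend on \<open>x * bar x\<close> only, and by \<open>mult_bar_inj\<close> nothing is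
lost on either side.\<close>

lemma norm_fun_norm_form:
  assumes "x \<noteq> 0" and "z = x * bar x"
  shows "norm_fun x * bar (norm_fun x) = (z ^ 2 + bar z + 1) * (bar z ^ 2 + z ^ 2 + 1) / bar z ^ 2"
  using assms by (simp add: norm_fun_def field_simps) (simp add: eval_nat_numeral algebra_simps)

lemma Tr_norm_fun:
  assumes "x \<noteq> 0"
  shows "Tr (norm_fun x * bar (norm_fun x)) = 1"
proof -
  define z where "z = x * bar x"
  then have z: "z \<noteq> 0" using assms by simp
  define w where "w = 1 / bar z"
  have w: "w * bar z = 1" using z by (simp add: w_def)
  have "norm_fun x * bar (norm_fun x) = (z ^ 2 + bar z + 1) * (bar z ^ 2 + z ^ 2 + 1) * w ^ 2"
    using norm_fun_norm_form[OF assms z_def] by (simp add: w_def power_divide)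
  also have "\<dots> = ((z + 1) ^ 2 + bar z) * ((bar z * w) ^ 2 + (z + 1) ^ 2 * w ^ 2)"
    by (simp add: square_add power_mult_distrib algebra_simps)
  also have "\<dots> = (z + 1) ^ 2 + bar z + (((z + 1) ^ 2 * w) ^ 2 + (z + 1) ^ 2 * w * (w * bar z))"
    using w by (simp add: algebra_simps power2_eq_square)
  also have "\<dots> = 1 + (z ^ 2 + bar z) + (((z + 1) ^ 2 * w) ^ 2 + (z + 1) ^ 2 * w)"
    by (simp only: w square_add) (simp add: add_ac)
  finally show ?thesis by simp
qed

text \<open>With \<open>z = s + bar s + 1\<close> the two factors in the numerator of the norm form become conjugates of the norms of
\<open>s + \<omega>\<close> and \<open>bar s + \<omega>\<close>, so that the norm form is the conjugate of the norm of \<open>kappa s + \<omega>\<close>. Every element of trace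
\<open>1\<close> is of this form.\<close>

lemma norm_fun_surj:
  assumes "Tr (y * bar y) = 1"
  obtains x where "x \<noteq> 0" "norm_fun x = y ^ 2"
proof -
  have "Tr ((y * bar y) ^ 2 + 1) = 0" using assms by simp
  then obtain v where "(y * bar y) ^ 2 + 1 = v ^ 2 + v" by (rule artin_schreier)
  then have "(y * bar y) ^ 2 = v ^ 2 + v + 1" by (rule eq_add_if_add_eq)
  moreover obtain u where "v = bar u" by (rule bar_surj)
  moreover obtain s where "kappa s = u" by (rule kappa_surj)
  ultimately have Y: "(y * bar y) ^ 2 = bar (kappa s ^ 2 + kappa s + 1)" by simp
  define z where "z = s + bar s + 1"
  \<comment> \<open>This is the solution of \<open>x * bar x = z\<close>, as \<open>bar (bar z) = z\<^sup>2\<close>.\<close>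
  define x where "x = bar z / z"
  have z: "z \<noteq> 0" using trace_denominator_nonzero by (simp add: z_def)
  then have x: "x \<noteq> 0" "z = x * bar x" by (simp_all add: x_def power2_eq_square)
  have z1: "z ^ 2 + bar z + 1 = bar (s ^ 2 + s + 1)"
    unfolding z_def bar_add bar_power bar_bar bar_1 by (simp add: eval_nat_numeral algebra_simps)
  have z2: "bar z ^ 2 + z ^ 2 + 1 = bar (bar s ^ 2 + bar s + 1)"
    unfolding z_def bar_add bar_power bar_bar bar_1 by (simp add: eval_nat_numeral algebra_simps)
  have "norm_fun x * bar (norm_fun x) = (y * bar y) ^ 2"
    unfolding Y quadratic_kappa norm_fun_norm_form[OF x] z1 z2 bar_mult bar_divide
    by (simp add: z_def)
  also have "\<dots> = y ^ 2 * bar (y ^ 2)" by (simp add: power_mult_distrib)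
  finally have "norm_fun x = y ^ 2" by (rule injD[OF mult_bar_inj])
  then show ?thesis using that x by blast
qed

section \<open>Semibent sets\<close>

definition walsh :: "'a set \<Rightarrow> 'a \<Rightarrow> int" where
  "walsh D a = (\<Sum>y\<in>D. chi (a * y))"

text \<open>A Boolean function with such a support has
Walsh spectrum \<open>0\<close>, \<open>\<plusminus> 2 ^ ((m + 1) div 2)\<close>, which is called semibent. Squares spare the case
distinction on the sign.\<close>

definition semibent_set :: "'a set \<Rightarrow> bool" where
  "semibent_set D \<longleftrightarrow>
     0 \<notin> D \<and> card D = 2 ^ (m - 1) \<and> (\<forall>a. a \<noteq> 0 \<longrightarrow> walsh D a ^ 2 \<in> {0, 2 ^ (m - 1)})"

lemma two_power_m: "2 ^ m = (2 * 2 ^ (m - 1) :: 'b::comm_semiring_1)"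
  using odd_m by (cases m) auto

text \<open>The classical evaluation of the square of a quadratic exponential sum: in the double sum over \<open>r\<close> and
\<open>r + h\<close> the sum over \<open>r\<close> vanishes unless \<open>h\<close> lies in the radical \<open>{0, h0}\<close>. The bijection \<open>g\<close> allows the
polarization to be written as \<open>Tr (g r * L h)\<close> without inverting Frobenius maps.\<close>

lemma quadratic_sum_square:
  fixes Q g L :: "'a \<Rightarrow> 'a"
  assumes polar: "\<And>r h. chi (Q (r + h)) = chi (Q r) * chi (Q h) * chi (g r * L h)"
    and "inj g" and "Q 0 = 0" and radical: "\<And>h. L h = 0 \<longleftrightarrow> h = 0 \<or> h = h0" and "h0 \<noteq> 0"
  shows "(\<Sum>r\<in>UNIV. chi (Q r)) ^ 2 \<in> {0, 4 * 2 ^ (m - 1)}"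
proof -
  have "bij g" using assms(2) inj_imp_surj by (simp add: bij_def)
  have "(\<Sum>r\<in>UNIV. chi (Q r)) ^ 2 = (\<Sum>r\<in>UNIV. \<Sum>u\<in>UNIV. chi (Q r) * chi (Q u))"
    by (simp add: power2_eq_square sum_product)
  also have "\<dots> = (\<Sum>r\<in>UNIV. \<Sum>h\<in>UNIV. chi (Q r) * chi (Q (r + h)))"
  proof (rule sum.cong[OF refl])
    fix r
    show "(\<Sum>u\<in>UNIV. chi (Q r) * chi (Q u)) = (\<Sum>h\<in>UNIV. chi (Q r) * chi (Q (r + h)))"
      by (rule sum.reindex_bij_witness[of _ "\<lambda>h. r + h" "\<lambda>u. r + u"]) auto
  qed
  also have "\<dots> = (\<Sum>r\<in>UNIV. \<Sum>h\<in>UNIV. chi (Q h) * chi (g r * L h))"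
  proof (intro sum.cong refl)
    fix r h
    show "chi (Q r) * chi (Q (r + h)) = chi (Q h) * chi (g r * L h)"
      by (simp add: polar flip: mult.assoc)
  qed
  also have "\<dots> = (\<Sum>h\<in>UNIV. chi (Q h) * (\<Sum>r\<in>UNIV. chi (g r * L h)))"
    by (subst sum.swap) (simp add: sum_distrib_left)
  also have "\<dots> = (\<Sum>h\<in>UNIV. chi (Q h) * (if L h = 0 then 2 ^ m else 0))"
    using sum.reindex_bij_betw[OF \<open>bij g\<close>, of "\<lambda>r. chi (r * L h)" for h] sum_chi_mult by simp
  also have "\<dots> = (\<Sum>h\<in>{0, h0}. chi (Q h) * 2 ^ m)"
    by (intro sum.mono_neutral_cong_right) (auto simp: radical)
  also have "\<dots> = (1 + chi (Q h0)) * (2 * 2 ^ (m - 1))"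
    using assms(3,5) by (simp add: two_power_m algebra_simps)
  finally show ?thesis by (simp add: chi_def)
qed

lemma card_Tr_preimage:
  fixes q :: "'a \<Rightarrow> 'a"
  assumes "inj q"
  shows "card {y. Tr (q y) = 1} = 2 ^ (m - 1)"
proof -
  have "q ` {y. Tr (q y) = 1} = {x. Tr x = 1}"
  proof
    show "{x. Tr x = 1} \<subseteq> q ` {y. Tr (q y) = 1}"
    proof
      fix x assume "x \<in> {x. Tr x = 1}"
      moreover obtain y where "x = q y" using surjD[OF inj_imp_surj[OF assms]] by blast
      ultimately show "x \<in> q ` {y. Tr (q y) = 1}" by blast
    qed
  qed auto
  then show ?thesis
    using card_Tr_fibres(2) card_image[OF inj_on_subset[OF assms subset_UNIV]] by metis
qed

text \<open>The indicator function of the set is \<open>(1 - chi (q y)) / 2\<close>.\<close>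

lemma semibent_trace_set:
  assumes "inj q" and "q 0 = 0"
    and "\<And>a. a \<noteq> 0 \<Longrightarrow> (\<Sum>y\<in>UNIV. chi (q y + a * y)) ^ 2 \<in> {0, 4 * 2 ^ (m - 1)}"
  shows "semibent_set {y. Tr (q y) = 1}"
proof -
  let ?D = "{y. Tr (q y) = 1}"
  have "card ?D = 2 ^ (m - 1)" using assms(1) by (rule card_Tr_preimage)
  moreover have "walsh ?D a ^ 2 \<in> {0, 2 ^ (m - 1)}" if a: "a \<noteq> 0" for a
  proof -
    have "2 * walsh ?D a = (\<Sum>y\<in>UNIV. (if y \<in> ?D then 2 * chi (a * y) else 0))"
      by (simp add: walsh_def sum_distrib_left flip: sum.inter_filter)
    also have "\<dots> = (\<Sum>y\<in>UNIV. chi (y * a) - chi (q y + a * y))"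
      by (rule sum.cong) (auto simp: chi_add chi_def[of "q _"] mult.commute)
    also have "\<dots> = - (\<Sum>y\<in>UNIV. chi (q y + a * y))"
      using a by (simp only: sum_subtractf sum_chi_mult) simp
    finally have "4 * walsh ?D a ^ 2 = (\<Sum>y\<in>UNIV. chi (q y + a * y)) ^ 2"
      using power_mult_distrib[of 2 "walsh ?D a" 2] by simp
    then show ?thesis using assms(3)[OF a] by auto
  qed
  ultimately show ?thesis using assms(2) by (simp add: semibent_set_def)
qed

lemma inj_square: "inj (\<lambda>r::'a. r ^ 2)"
proof (rule injI)
  fix x y :: 'a
  assume "x ^ 2 = y ^ 2"
  then have "(x + y) ^ 2 = 0" by (simp add: square_add)
  then show "x = y" by simp
qed

lemma semibent_cube: "semibent_set {y. Tr (y ^ 3) = 1}"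
proof (rule semibent_trace_set)
  fix a :: 'a
  show "(\<Sum>y\<in>UNIV. chi (y ^ 3 + a * y)) ^ 2 \<in> {0, 4 * 2 ^ (m - 1)}"
  proof (rule quadratic_sum_square)
    fix r h :: 'a
    have "(r + h) ^ 3 + a * (r + h) = (r ^ 3 + a * r) + (h ^ 3 + a * h) + (r ^ 2 * h + r * h ^ 2)"
      by (simp add: eval_nat_numeral algebra_simps)
    moreover have "chi (r * h ^ 2) = chi (r ^ 2 * h ^ 4)"
      using chi_square[of "r * h ^ 2"] by (simp add: power_mult_distrib flip: power_mult)
    ultimately show "chi ((r + h) ^ 3 + a * (r + h))
        = chi (r ^ 3 + a * r) * chi (h ^ 3 + a * h) * chi (r ^ 2 * (h + h ^ 4))"
      by (simp add: chi_add distrib_left)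
    have "h + h ^ 4 = h * (1 + h ^ 3)" by (simp add: eval_nat_numeral algebra_simps)
    then show "h + h ^ 4 = 0 \<longleftrightarrow> h = 0 \<or> h = 1"
      using cube_eq_iff[of 1 h] by (simp only: mult_eq_0_iff add_eq_zero_iff power_one) blast
  next
    show "inj (\<lambda>r::'a. r ^ 2)"
      by (rule inj_square)
  qed auto
qed (auto simp: inj_def cube_eq_iff)

lemma semibent_norm: "semibent_set {y. Tr (y * bar y) = 1}"
proof (rule semibent_trace_set[OF mult_bar_inj])
  fix a :: 'a
  show "(\<Sum>y\<in>UNIV. chi (y * bar y + a * y)) ^ 2 \<in> {0, 4 * 2 ^ (m - 1)}"
  proof (rule quadratic_sum_square)
    fix r h :: 'a
    have "(r + h) * bar (r + h) + a * (r + h)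
        = (r * bar r + a * r) + (h * bar h + a * h) + (r * bar h + bar r * h)"
      by (simp add: algebra_simps)
    moreover have "chi (r * bar h) = chi (r ^ 2 * bar h ^ 2)"
      using chi_square[of "r * bar h"] by (simp add: power_mult_distrib)
    moreover have "chi (bar r * h) = chi (r ^ 2 * bar h)"
      using Tr_bar[of "bar r * h"] by (simp add: chi_def)
    ultimately show "chi ((r + h) * bar (r + h) + a * (r + h))
        = chi (r * bar r + a * r) * chi (h * bar h + a * h) * chi (r ^ 2 * (bar h ^ 2 + bar h))"
      by (simp add: chi_add distrib_left)
    have "bar h ^ 2 + bar h = bar h * bar (h + 1)" by (simp add: algebra_simps power2_eq_square)
    then show "bar h ^ 2 + bar h = 0 \<longleftrightarrow> h = 0 \<or> h = 1"
      by (simp only: mult_eq_0_iff bar_eq_0_iff add_eq_zero_iff)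
  next
    show "inj (\<lambda>r::'a. r ^ 2)"
      by (rule inj_square)
  qed auto
qed simp

section \<open>The trinomial of Segre type\<close>

text \<open>\<open>r ^ 6\<close> is Segre's o-monomial, which defines a hyperoval when \<open>m\<close> is odd; this is equivalent to the
two-to-one property of \<open>r ^ 6 + a * r\<close> for \<open>a \<noteq> 0\<close>.\<close>

definition hyperoval :: "'a \<Rightarrow> 'a" where "hyperoval r = r ^ 6 + r"

definition segre_fun :: "'a \<Rightarrow> 'a" where "segre_fun x = 1 / x ^ 4 + x ^ 6 + x"

lemma segre_fun_scaled:
  assumes "x \<noteq> 0"
  shows "segre_fun (t * x) * x ^ 4 = (1 / t) ^ 4 + (x ^ 5) ^ 2 * t ^ 6 + x ^ 5 * t"
proof -
  have "1 / (t * x) ^ 4 * x ^ 4 = (1 / t) ^ 4"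
    using assms by (simp add: power_mult_distrib power_divide)
  moreover have "(t * x) ^ 6 * x ^ 4 = (x ^ 5) ^ 2 * t ^ 6" "t * x * x ^ 4 = x ^ 5 * t"
    by (simp_all add: eval_nat_numeral ac_simps)
  ultimately show ?thesis by (simp only: segre_fun_def distrib_right)
qed

lemma sixth_power_add_1: "t ^ 6 + 1 = ((t + 1) * (t ^ 2 + t + 1)) ^ 2" for t :: 'a
  by (simp add: eval_nat_numeral algebra_simps)

text \<open>With \<open>r = t * x\<close> and \<open>z = x ^ 5\<close> a coincidence is a quadratic equation for \<open>z\<close>. In
Artin-Schreier normal form its constant term is the square of \<open>t\<^sup>2 + t + 1\<close>, which has trace \<open>1\<close>.\<close>

lemma segre_fun_neq_hyperoval:
  assumes "x \<noteq> 0"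
  shows "segre_fun x \<noteq> hyperoval r"
proof
  assume eq: "segre_fun x = hyperoval r"
  define t z k where "t = r / x" and "z = x ^ 5" and "k = t ^ 2 + t + 1"
  define u where "u = z * (t + 1) * k ^ 2"
  have r: "r = t * x" using assms by (simp add: t_def)
  have "segre_fun x * x ^ 4 = 1 + z ^ 2 + z"
    using segre_fun_scaled[OF assms, of 1] by (simp add: z_def)
  moreover have "hyperoval r * x ^ 4 = z ^ 2 * t ^ 6 + z * t"
    unfolding hyperoval_def r z_def by (simp add: eval_nat_numeral algebra_simps)
  ultimately have "1 + z ^ 2 + z = z ^ 2 * t ^ 6 + z * t" by (simp only: eq)
  then have "(1 + z ^ 2 + z) + (z ^ 2 * t ^ 6 + z * t) = 0" by simp
  then have "z ^ 2 * (t ^ 6 + 1) + z * (t + 1) + 1 = 0" by (simp add: algebra_simps)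
  moreover have "u ^ 2 + u + k ^ 2 = (z ^ 2 * ((t + 1) * k) ^ 2 + z * (t + 1) + 1) * k ^ 2"
    by (simp add: u_def eval_nat_numeral algebra_simps)
  ultimately have "u ^ 2 + u + k ^ 2 = 0"
    by (simp only: sixth_power_add_1 mult_zero_left flip: k_def)
  then have "Tr (u ^ 2 + u + k ^ 2) = 0" by (simp only: Tr_0)
  then show False by (simp add: k_def)
qed

text \<open>Collisions of \<open>segre_fun\<close> are best described by the ratio \<open>t\<close> of the two arguments: the equation is then quadratic in
\<open>x ^ 5\<close> and its solutions are rational functions of \<open>t\<close>. This lemma treats the solution \<open>x ^ 5 = 1 / (t\<^sup>2 * (t + 1))\<close>. Each such
collision pairs an element with \<open>Tr (x ^ 5) = 1\<close>, a centre, with an element that is not a centre.\<close>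

lemma segre_fun_partner:
  assumes "x \<noteq> 0" and "x ^ 5 * (t ^ 2 * (t + 1)) = 1"
  shows "segre_fun (t * x) = segre_fun x" and "Tr ((t * x) ^ 5) = Tr (x ^ 5) + 1"
proof -
  define i where "i = 1 / t"
  define z where "z = x ^ 5"
  have t: "t \<noteq> 0" "t + 1 \<noteq> 0" using assms(2) by auto
  have i: "i * t = 1" using t by (simp add: i_def)
  have z: "z = i ^ 2 / (t + 1)" using assms(2) t by (simp add: z_def i_def field_simps)
  have "(segre_fun (t * x) + segre_fun x) * x ^ 4 = i ^ 4 + 1 + z ^ 2 * (t ^ 6 + 1) + z * (t + 1)"
    using segre_fun_scaled[OF assms(1), of t] segre_fun_scaled[OF assms(1), of 1]
    by (simp add: i_def z_def distrib_right distrib_left add_ac)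
  also have "\<dots> = i ^ 4 + 1 + (i ^ 2 * (t ^ 2 + t + 1)) ^ 2 + i ^ 2"
    unfolding z using t by (simp add: sixth_power_add_1 power_mult_distrib power_divide)
  also have "\<dots> = i ^ 4 + 1 + (i * t) ^ 4 + (i * t) ^ 2 * i ^ 2 + i ^ 4 + i ^ 2"
    by (simp add: square_add power_mult_distrib eval_nat_numeral algebra_simps)
  also have "\<dots> = 0" using i by (simp add: add_ac)
  finally show "segre_fun (t * x) = segre_fun x" using assms(1) by simp
  have "z * (t ^ 5 + 1) = (t ^ 4 + t ^ 3 + t ^ 2 + t + 1) * i ^ 2"
  proof -
    have "t ^ 5 + 1 = (t + 1) * (t ^ 4 + t ^ 3 + t ^ 2 + t + 1)"
      by (simp add: eval_nat_numeral algebra_simps)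
    then show ?thesis unfolding z using t by simp
  qed
  also have "\<dots> = t ^ 2 * (i * t) ^ 2 + t * (i * t) ^ 2 + (i * t) ^ 2 + i * (i * t) + i ^ 2"
    by (simp add: power_mult_distrib eval_nat_numeral algebra_simps)
  also have "\<dots> = (t ^ 2 + t) + 1 + (i ^ 2 + i)"
    unfolding i by (simp add: add_ac)
  finally have "(t * x) ^ 5 + z = (t ^ 2 + t) + 1 + (i ^ 2 + i)"
    by (simp add: z_def power_mult_distrib distrib_left mult_ac)
  then have "(t * x) ^ 5 = (t ^ 2 + t) + 1 + (i ^ 2 + i) + z" by (rule eq_add_if_add_eq)
  then show "Tr ((t * x) ^ 5) = Tr (x ^ 5) + 1" by (simp add: z_def add.commute)
qed

text \<open>For \<open>s = 1 / t\<close> the condition is the cubic equation \<open>s ^ 3 = z * s + z\<close> with \<open>z = x ^ 5\<close>. Cardano's formula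
\<open>s = w + z / w\<close> needs a root \<open>w ^ 3 = z * v\<close> of the quadratic resolvent, which exists because \<open>Tr z = 0\<close>.\<close>

lemma segre_fun_partner_exists:
  assumes "x \<noteq> 0" and "Tr (x ^ 5) = 0"
  obtains t where "x ^ 5 * (t ^ 2 * (t + 1)) = 1"
proof -
  define z where "z = x ^ 5"
  have z: "z \<noteq> 0" "Tr z = 0" using assms by (simp_all add: z_def)
  obtain v where v: "z = v ^ 2 + v" using z(2) by (rule artin_schreier)
  then have v0: "v \<noteq> 0" using z(1) by auto
  obtain w where w: "w ^ 3 = z * v" using surjD[OF surj_cube] by metis
  have w0: "w \<noteq> 0" using w z(1) v0 by auto
  define q where "q = z / w"
  define s where "s = w + q"
  have wq: "w * q = z" using w0 by (simp add: q_def)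
  have "v ^ 2 + z = v" using v by (simp add: add_ac)
  have "s ^ 3 = w ^ 3 + q ^ 3 + (w * q) * s"
    by (simp add: s_def eval_nat_numeral algebra_simps)
  moreover have "w ^ 3 + q ^ 3 = z"
  proof -
    have "z * v * (w ^ 3 + q ^ 3) = (w ^ 3) ^ 2 + (w * q) ^ 3"
      by (simp add: power_mult_distrib distrib_left power2_eq_square flip: w)
    also have "\<dots> = z ^ 2 * (v ^ 2 + z)"
      by (simp only: w wq) (simp add: eval_nat_numeral algebra_simps)
    also have "\<dots> = z * v * z"
      by (simp only: \<open>v ^ 2 + z = v\<close>) (simp add: power2_eq_square)
    finally show ?thesis using z(1) v0 by simp
  qed
  ultimately have s3: "s ^ 3 = z + z * s" by (simp only: wq)
  then have s: "s \<noteq> 0" using z(1) by (auto simp: zero_power)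
  have "z * ((1 / s) ^ 2 * (1 / s + 1)) = (z + z * s) / s ^ 3"
    using s by (simp add: field_simps eval_nat_numeral)
  also have "\<dots> = 1" using s by (simp flip: s3)
  finally show ?thesis using that by (simp only: z_def)
qed

text \<open>The quadratic equation for \<open>x ^ 5\<close> has two solutions. One is excluded by \<open>segre_fun_partner\<close>, since only one of the two
arguments would be a centre; the other makes \<open>x ^ 5\<close> of the form \<open>l\<^sup>2 + l\<close>, so neither would be one.\<close>

lemma segre_fun_inj_on_centres: "inj_on segre_fun {x. Tr (x ^ 5) = 1}"
proof (rule inj_onI, rule ccontr)
  fix x y assume "x \<in> {x. Tr (x ^ 5) = 1}" "y \<in> {x. Tr (x ^ 5) = 1}"
    and eq: "segre_fun x = segre_fun y" and ne: "x \<noteq> y"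
  then have Tr: "Tr (x ^ 5) = 1" "Tr (y ^ 5) = 1" by auto
  then have nz: "x \<noteq> 0" "y \<noteq> 0" by (auto simp: zero_power)
  define t where "t = y / x"
  define i z k where "i = 1 / t" and "z = x ^ 5" and "k = t ^ 2 + t + 1"
  define u where "u = z * (t + 1) * k ^ 2"
  have y: "y = t * x" using nz by (simp add: t_def)
  have t: "t \<noteq> 0" "t + 1 \<noteq> 0" using nz ne by (auto simp: t_def)
  have i: "i * t = 1" using t by (simp add: i_def)
  have k: "k \<noteq> 0" unfolding k_def by (rule quadratic_nonzero)
  have "(segre_fun (t * x) + segre_fun x) * x ^ 4 = i ^ 4 + 1 + z ^ 2 * (t ^ 6 + 1) + z * (t + 1)"
    using segre_fun_scaled[OF nz(1), of t] segre_fun_scaled[OF nz(1), of 1]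
    by (simp add: i_def z_def distrib_right distrib_left add_ac)
  then have "i ^ 4 + 1 + z ^ 2 * ((t + 1) * k) ^ 2 + z * (t + 1) = 0"
    by (simp only: eq y add_self mult_zero_left sixth_power_add_1 flip: k_def)
  moreover have "(u ^ 2 + u) + (k * (i ^ 2 + 1)) ^ 2
      = (i ^ 4 + 1 + z ^ 2 * ((t + 1) * k) ^ 2 + z * (t + 1)) * k ^ 2"
    by (simp add: u_def eval_nat_numeral algebra_simps)
  ultimately have "(u ^ 2 + u) + (k * (i ^ 2 + 1)) ^ 2 = 0" by (simp only: mult_zero_left)
  then have u: "u ^ 2 + u = (k * (i ^ 2 + 1)) ^ 2" by (simp only: add_eq_zero_iff)
  \<comment> \<open>\<open>(k * (i\<^sup>2 + 1))\<^sup>2 = e\<^sup>2 + e\<close>, so \<open>u\<close> is \<open>e\<close> or \<open>e + 1\<close>.\<close>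
  define e where "e = t ^ 2 + i ^ 2"
  have "k * (i ^ 2 + 1) = (i * t) ^ 2 + i * (i * t) + i ^ 2 + k"
    by (simp add: k_def power_mult_distrib eval_nat_numeral algebra_simps)
  then have "k * (i ^ 2 + 1) = t ^ 2 + t + i ^ 2 + i"
    unfolding i by (simp add: k_def add_ac)
  then have "(k * (i ^ 2 + 1)) ^ 2 = e ^ 2 + e"
    by (simp add: e_def square_add add_ac)
  moreover have "(u + e) * (u + e + 1) = (u ^ 2 + u) + (e ^ 2 + e)"
    by (simp add: power2_eq_square algebra_simps)
  ultimately have "(u + e) * (u + e + 1) = 0" by (simp only: u add_self)
  then consider "u = e" | "u = e + 1" by (auto simp: add.assoc)
  then show False
  proof cases
    case 1
    define l where "l = i / k"
    have l: "l * k = i" using k by (simp add: l_def)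
    have "z * ((t + 1) * k ^ 2) = (t + 1) ^ 4 * i ^ 2"
    proof -
      have "z * ((t + 1) * k ^ 2) = t ^ 2 * (i * t) ^ 2 + i ^ 2"
        using 1 by (simp add: u_def e_def i mult_ac)
      also have "\<dots> = (t + 1) ^ 4 * i ^ 2"
        by (simp add: power_mult_distrib eval_nat_numeral algebra_simps)
      finally show ?thesis .
    qed
    then have "(z * k ^ 2) * (t + 1) = ((t + 1) ^ 3 * i ^ 2) * (t + 1)"
      by (simp add: eval_nat_numeral mult_ac)
    then have "z * k ^ 2 = (t + 1) ^ 3 * i ^ 2" using t(2) mult_right_cancel by blast
    also have "\<dots> = i ^ 2 + i * k * (i * t)"
      by (simp add: k_def eval_nat_numeral algebra_simps)
    also have "\<dots> = i ^ 2 + i * k" by (simp only: i mult_1_right)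
    also have "\<dots> = (l ^ 2 + l) * k ^ 2"
      by (simp only: flip: l) (simp add: power2_eq_square algebra_simps)
    finally have "z = l ^ 2 + l" using k by simp
    then show False using Tr(1) by (simp add: z_def)
  next
    case 2
    have "i ^ 2 * k ^ 2 = i ^ 2 + (i * t) ^ 2 + t ^ 2 * (i * t) ^ 2"
      by (simp add: k_def power_mult_distrib eval_nat_numeral algebra_simps)
    then have "i ^ 2 * k ^ 2 = e + 1" unfolding i by (simp add: e_def add_ac)
    then have "(z * (t + 1)) * k ^ 2 = i ^ 2 * k ^ 2" using 2 by (simp add: u_def)
    then have "z * (t + 1) = i ^ 2" using k by simp
    then have "z * (t ^ 2 * (t + 1)) = (i * t) ^ 2" by (simp add: power_mult_distrib mult_ac)
    then have "x ^ 5 * (t ^ 2 * (t + 1)) = 1" unfolding i z_def by simp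
    then have "Tr (y ^ 5) = Tr (x ^ 5) + 1" unfolding y by (rule segre_fun_partner(2)[OF nz(1)])
    then show False using Tr by simp
  qed
qed

lemma segre_fun_image: "segre_fun ` (- {0}) = segre_fun ` {x. Tr (x ^ 5) = 1}"
proof
  show "segre_fun ` (- {0}) \<subseteq> segre_fun ` {x. Tr (x ^ 5) = 1}"
  proof
    fix y assume "y \<in> segre_fun ` (- {0})"
    then obtain x where x: "x \<noteq> 0" "y = segre_fun x" by auto
    show "y \<in> segre_fun ` {x. Tr (x ^ 5) = 1}"
    proof (cases "Tr (x ^ 5) = 0")
      case True
      then obtain t where "x ^ 5 * (t ^ 2 * (t + 1)) = 1" using segre_fun_partner_exists x by blast
      then have "segre_fun (t * x) = y" "Tr ((t * x) ^ 5) = 1"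
        using segre_fun_partner[OF x(1)] x(2) True by auto
      then show ?thesis by blast
    qed (use x in auto)
  qed
qed (auto simp: zero_power)

text \<open>By the preceding lemmas the values are in bijection with the centres.\<close>

lemma card_segre_fun_image: "card (segre_fun ` (- {0})) = 2 ^ (m - 1)"
  using card_Tr_preimage[OF inj_fifth_power]
  by (simp only: segre_fun_image card_image[OF segre_fun_inj_on_centres])

text \<open>The Dickson polynomial \<open>D\<^sub>5(X, 1)\<close> in characteristic 2. Divided by \<open>a + b\<close>, a collision is
a quadratic equation for \<open>a * b\<close> in terms of \<open>P = (a + b)\<^sup>2 + 1\<close>; in Artin-Schreier form its constant term has trace
\<open>1\<close>.\<close>

lemma dickson5_inj:
  assumes eq: "a ^ 5 + a ^ 3 + a = b ^ 5 + b ^ 3 + (b::'a)"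
  shows "a = b"
proof (rule ccontr)
  assume ne: "a \<noteq> b"
  define q P where "q = a * b" and "P = (a + b) ^ 2 + 1"
  have "(a ^ 5 + a ^ 3 + a) + (b ^ 5 + b ^ 3 + b) = (a + b) * (q ^ 2 + q * P + P ^ 2 + P + 1)"
    by (simp add: q_def P_def eval_nat_numeral algebra_simps)
  then have zero: "q ^ 2 + q * P + P ^ 2 + P + 1 = 0"
    using ne by (simp only: eq add_self) simp
  show False
  proof (cases "P = 0")
    case True
    then have "(q + 1) ^ 2 = 0" "(a + b + 1) ^ 2 = 0"
      using zero by (simp_all add: P_def square_add)
    then have "a * b = 1" "b = a + 1" by (simp_all add: q_def add.assoc)
    then have "a ^ 2 + a + 1 = 0" by (simp add: power2_eq_square distrib_left)
    then show False using quadratic_nonzero by blast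
  next
    case False
    have "(q / P) ^ 2 + q / P + 1 + (1 / P + (1 / P) ^ 2) = (q ^ 2 + q * P + P ^ 2 + P + 1) / P ^ 2"
      using False by (simp add: power_divide add_divide_distrib power2_eq_square)
    then have "Tr ((q / P) ^ 2 + q / P + 1 + (1 / P + (1 / P) ^ 2)) = 0"
      by (simp only: zero div_0 Tr_0)
    then show False by (simp add: power_divide[symmetric] del: power_one_over)
  qed
qed

lemma hyperoval_ratio:
  assumes "r \<noteq> 0" and "t \<noteq> 1" and "hyperoval (t * r) = hyperoval r"
  shows "r ^ 5 * ((t + 1) ^ 5 + (t + 1) ^ 3 + (t + 1)) = 1"
proof -
  have "hyperoval (t * r) + hyperoval r
      = r * (t + 1) * (r ^ 5 * ((t + 1) ^ 5 + (t + 1) ^ 3 + (t + 1)) + 1)"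
    by (simp add: hyperoval_def eval_nat_numeral algebra_simps)
  then show ?thesis using assms by simp
qed

text \<open>For \<open>r \<noteq> 0\<close> the ratio \<open>t\<close> to another element of the fibre satisfies \<open>D\<^sub>5(t + 1, 1) = r^-5\<close>, which has only one
solution.\<close>

lemma card_hyperoval_fibre_le: "card {r. hyperoval r = y} \<le> 2"
proof (cases "\<exists>r. r \<noteq> 0 \<and> hyperoval r = y")
  case True
  then obtain r where r: "r \<noteq> 0" "hyperoval r = y" by blast
  have "\<exists>w. \<forall>u. hyperoval u = y \<and> u \<noteq> r \<longrightarrow> u = w"
  proof (rule ccontr)
    assume "\<not> ?thesis"
    then obtain u v where uv: "hyperoval u = y" "u \<noteq> r" "hyperoval v = y" "v \<noteq> r" "u \<noteq> v" by metis
    have ratio: "r ^ 5 * ((u / r + 1) ^ 5 + (u / r + 1) ^ 3 + (u / r + 1)) = 1"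
         "r ^ 5 * ((v / r + 1) ^ 5 + (v / r + 1) ^ 3 + (v / r + 1)) = 1"
      using r uv by (simp_all add: hyperoval_ratio)
    have "r ^ 5 \<noteq> 0" using r(1) by simp
    then have "(u / r + 1) ^ 5 + (u / r + 1) ^ 3 + (u / r + 1)
        = (v / r + 1) ^ 5 + (v / r + 1) ^ 3 + (v / r + 1)"
      by (rule mult_left_cancel[THEN iffD1]) (simp only: ratio)
    then have "u / r + 1 = v / r + 1" by (rule dickson5_inj)
    then show False using uv(5) r(1) by simp
  qed
  then obtain w where "\<forall>u. hyperoval u = y \<and> u \<noteq> r \<longrightarrow> u = w" by blast
  then have "{r. hyperoval r = y} \<subseteq> {r, w}" by auto
  then have "card {r. hyperoval r = y} \<le> card {r, w}" by (intro card_mono) auto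
  also have "\<dots> \<le> 2" by (simp add: card_insert_if)
  finally show ?thesis .
next
  case False
  then have "{r. hyperoval r = y} \<subseteq> {0}" by auto
  then have "card {r. hyperoval r = y} \<le> card {0::'a}" by (intro card_mono) auto
  then show ?thesis by simp
qed

text \<open>The two images are disjoint, and the first fills half of the field. Fibres of size at most two force the
second to fill at least the other half, so all inequalities are equalities.\<close>

lemma segre_fun_image_eq: "segre_fun ` (- {0}) = - range hyperoval"
  and card_hyperoval_fibre: "y \<in> range hyperoval \<Longrightarrow> card {r. hyperoval r = y} = 2"
proof -
  have sub: "range hyperoval \<subseteq> - (segre_fun ` (- {0}))"
  proof (rule subsetI, rule ComplI)
    fix y assume "y \<in> range hyperoval" "y \<in> segre_fun ` (- {0})"
    then obtain r x where "y = hyperoval r" "y = segre_fun x" "x \<in> - {0}" by blast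
    then show False using segre_fun_neq_hyperoval[of x r] by simp
  qed
  have card: "card (- (segre_fun ` (- {0}))) = 2 ^ (m - 1)"
  proof -
    have "card (- (segre_fun ` (- {0}))) = CARD('a) - card (segre_fun ` (- {0}))"
      by (subst Compl_eq_Diff_UNIV) (rule card_Diff_subset; simp)
    then show ?thesis unfolding card_segre_fun_image card_field two_power_m by simp
  qed
  then have le: "card (range hyperoval) \<le> 2 ^ (m - 1)" using card_mono[OF finite sub] by simp
  have "2 * 2 ^ (m - 1) = (\<Sum>r\<in>(UNIV::'a set). 1::nat)"
    by (simp add: card_field two_power_m)
  also have "\<dots> = (\<Sum>y\<in>range hyperoval. card {r. hyperoval r = y})"
    by (subst sum.image_gen[where g = hyperoval]) simp_all
  finally have total: "(\<Sum>y\<in>range hyperoval. card {r. hyperoval r = y}) = 2 * 2 ^ (m - 1)" ..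
  also have "\<dots> \<ge> (\<Sum>y\<in>range hyperoval. 2)" using le by simp
  finally have "(\<Sum>y\<in>range hyperoval. 2 - card {r. hyperoval r = y}) = 0"
    by (subst sum_subtractf_nat) (simp_all add: card_hyperoval_fibre_le)
  have fibre: "card {r. hyperoval r = y} = 2" if "y \<in> range hyperoval" for y
  proof (rule le_antisym[OF card_hyperoval_fibre_le])
    have "\<forall>y\<in>range hyperoval. 2 - card {r. hyperoval r = y} = 0"
      using \<open>(\<Sum>y\<in>range hyperoval. 2 - card {r. hyperoval r = y}) = 0\<close>
      by (simp only: sum_eq_0_iff[OF finite])
    then have "2 - card {r. hyperoval r = y} = 0" using that by (rule bspec)
    then show "2 \<le> card {r. hyperoval r = y}" by simp
  qed
  then show "y \<in> range hyperoval \<Longrightarrow> card {r. hyperoval r = y} = 2" .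
  have "card (range hyperoval) = 2 ^ (m - 1)"
  proof -
    have "(\<Sum>y\<in>range hyperoval. card {r. hyperoval r = y}) = (\<Sum>y\<in>range hyperoval. 2)"
      by (rule sum.cong[OF refl fibre])
    then show ?thesis unfolding total by simp
  qed
  then have "range hyperoval = - (segre_fun ` (- {0}))"
    using card_subset_eq[OF finite sub] card by simp
  then show "segre_fun ` (- {0}) = - range hyperoval" by blast
qed

text \<open>For \<open>a \<noteq> 0\<close> complementary sets have opposite character sums, and those over the image of the two-to-one map are half the
sums of \<open>chi (a * (r ^ 6 + r))\<close> over the whole field.\<close>

lemma semibent_segre_fun: "semibent_set (segre_fun ` (- {0}))"
proof -
  let ?D = "segre_fun ` (- {0})"
  have "hyperoval 0 = 0" by (simp add: hyperoval_def)
  then have "0 \<notin> ?D" unfolding segre_fun_image_eq by (metis ComplD rangeI)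
  moreover have "walsh ?D a ^ 2 \<in> {0, 2 ^ (m - 1)}" if a: "a \<noteq> 0" for a
  proof -
    have "walsh ?D a + walsh (range hyperoval) a = (\<Sum>y\<in>UNIV. chi (y * a))"
      unfolding walsh_def segre_fun_image_eq
      by (subst sum.union_disjoint[symmetric]) (auto simp: mult.commute Compl_partition2)
    then have "walsh ?D a = - walsh (range hyperoval) a" using a by (simp add: sum_chi_mult)
    moreover have "2 * walsh (range hyperoval) a = (\<Sum>r\<in>UNIV. chi (a * hyperoval r))"
    proof -
      have "(\<Sum>r\<in>UNIV. chi (a * hyperoval r))
          = (\<Sum>y\<in>range hyperoval. \<Sum>r\<in>{r. hyperoval r = y}. chi (a * hyperoval r))"
        by (subst sum.image_gen[where g = hyperoval]) simp_all
      also have "\<dots> = (\<Sum>y\<in>range hyperoval. 2 * chi (a * y))"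
        by (rule sum.cong) (simp_all add: card_hyperoval_fibre)
      finally show ?thesis by (simp add: walsh_def sum_distrib_left)
    qed
    moreover have "(\<Sum>r\<in>UNIV. chi (a * hyperoval r)) ^ 2 \<in> {0, 4 * 2 ^ (m - 1)}"
    proof -
      \<comment> \<open>The radical equation \<open>a * h ^ 6 = 1\<close> has exactly one solution.\<close>
      obtain w where "1 / a = w ^ 3" using surjD[OF surj_cube] by blast
      moreover obtain h0 where "w = h0 ^ 2" using surjD[OF inj_imp_surj[OF inj_square]] by blast
      ultimately have h0: "(h0 ^ 2) ^ 3 = 1 / a" by simp
      let ?L = "\<lambda>h. a * h ^ 2 + a ^ 2 * h ^ 8"
      show ?thesis
      proof (rule quadratic_sum_square)
        fix r h :: 'a
        have "a * hyperoval (r + h) = a * hyperoval r + a * hyperoval h + (r ^ 4 * (a * h ^ 2) + a * r ^ 2 * h ^ 4)"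
          by (simp add: hyperoval_def eval_nat_numeral algebra_simps)
        moreover have "chi (a * r ^ 2 * h ^ 4) = chi (r ^ 4 * (a ^ 2 * h ^ 8))"
          using chi_square[of "a * r ^ 2 * h ^ 4"] by (simp add: power_mult_distrib mult_ac flip: power_mult)
        ultimately show "chi (a * hyperoval (r + h))
            = chi (a * hyperoval r) * chi (a * hyperoval h) * chi (r ^ 4 * ?L h)"
          by (simp add: chi_add distrib_left)
        have "?L h = a * h ^ 2 * (1 + a * (h ^ 2) ^ 3)"
          by (simp add: eval_nat_numeral algebra_simps)
        moreover have "1 + a * (h ^ 2) ^ 3 = 0 \<longleftrightarrow> (h ^ 2) ^ 3 = (h0 ^ 2) ^ 3"
          using a by (simp only: h0 add_eq_zero_iff) (auto simp: field_simps)
        ultimately show "?L h = 0 \<longleftrightarrow> h = 0 \<or> h = h0"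
          using a by (simp only: mult_eq_0_iff power_eq_0_iff cube_eq_iff inj_eq[OF inj_square]) simp
      next
        show "inj (\<lambda>r::'a. r ^ 4)"
          using inj_compose[OF inj_square inj_square] by (simp add: o_def flip: power_mult)
        show "a * hyperoval 0 = 0" by (simp add: hyperoval_def)
        show "h0 \<noteq> 0" using h0 a by auto
      qed
    qed
    moreover have "4 * walsh (range hyperoval) a ^ 2 = (2 * walsh (range hyperoval) a) ^ 2"
      by (simp add: power_mult_distrib)
    ultimately have "4 * walsh ?D a ^ 2 \<in> {0, 4 * 2 ^ (m - 1)}"
      by (simp only: power2_minus)
    then show ?thesis by auto
  qed
  ultimately show ?thesis by (simp add: semibent_set_def card_segre_fun_image)
qed

end

section \<open>Binary linear codes and their duals\<close>

text \<open>All dimensions below are obtained by counting elements.\<close>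

lemma (in vectorspace) card_carrier_eq_power_dim:
  assumes "finite (carrier V)" and "finite (carrier K)"
  shows "card (carrier V) = card (carrier K) ^ dim"
proof -
  have "gen_set (carrier V)"
    using span_is_subset2[of "carrier V"] in_own_span[of "carrier V"] by auto
  then have "fin_dim" unfolding fin_dim_def using assms(1) by blast
  then obtain B where B: "finite B" "basis B" using finite_basis_exists by blast
  then have BV: "B \<subseteq> carrier V" by (simp add: basis_def)
  have "\<forall>v\<in>carrier V. \<exists>!a. a \<in> B \<rightarrow>\<^sub>E carrier K \<and> lincomb a B = v"
    using basis_criterion[OF B(1) BV] B(2) by blast
  moreover have "lincomb a B \<in> carrier V" if "a \<in> B \<rightarrow>\<^sub>E carrier K" for a
    using that lincomb_closed[OF BV] by auto
  ultimately have "bij_betw (\<lambda>a. lincomb a B) (B \<rightarrow>\<^sub>E carrier K) (carrier V)"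
    unfolding bij_betw_def inj_on_def by blast
  then have "card (carrier V) = card (B \<rightarrow>\<^sub>E carrier K)"
    by (simp add: bij_betw_same_card)
  also have "\<dots> = card (carrier K) ^ card B"
    using B(1) by (simp add: card_PiE)
  finally show ?thesis using dim_basis[OF B] by simp
qed

lemma card_bit: "card (UNIV :: bit set) = 2"
proof -
  have "card (UNIV :: bit set) = card {0 :: bit, 1}" by (rule arg_cong[of _ _ card]) auto
  also have "\<dots> = 2" by simp
  finally show ?thesis .
qed

lemma subspace_bit_vecI:
  assumes "C \<subseteq> carrier_vec n" and "0\<^sub>v n \<in> C"
    and add: "\<And>u v. u \<in> C \<Longrightarrow> v \<in> C \<Longrightarrow> u + v \<in> C"
  shows "VectorSpace.subspace class_ring C (module_vec TYPE(bit) n)"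
proof -
  interpret V: vectorspace "class_ring :: bit ring" "module_vec TYPE(bit) n" by (rule vec_vs)
  have "b \<cdot>\<^sub>v u \<in> C" if "u \<in> C" for b u
  proof (cases "b = 0")
    case True
    have "b \<cdot>\<^sub>v u = 0\<^sub>v n" using True that assms(1) by (intro eq_vecI) auto
    then show ?thesis using assms(2) by simp
  next
    case False
    then have "b \<cdot>\<^sub>v u = u" by (intro eq_vecI) auto
    then show ?thesis using that by simp
  qed
  then have "submodule class_ring C (module_vec TYPE(bit) n)"
    using assms by unfold_locales (auto simp: module_vec_simps class_ring_simps)
  then show ?thesis using vec_vs by (intro VectorSpace.subspace.intro)
qed

lemma dim_eq_if_card_eq:
  assumes sub: "VectorSpace.subspace class_ring C (module_vec TYPE(bit) n)"
    and "C \<subseteq> carrier_vec n" and "card C = 2 ^ k"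
  shows "vectorspace.dim class_ring (module_vec TYPE(bit) n\<lparr>carrier := C\<rparr>) = k"
proof -
  interpret V: vectorspace "class_ring :: bit ring" "module_vec TYPE(bit) n" by (rule vec_vs)
  interpret C: vectorspace "class_ring :: bit ring" "module_vec TYPE(bit) n\<lparr>carrier := C\<rparr>"
    by (rule V.subspace_is_vs[OF sub])
  have "finite C" using assms(3) by (metis card.infinite power_not_zero zero_neq_numeral)
  moreover have "finite (UNIV :: bit set)" using card_bit by (simp add: card_ge_0_finite)
  ultimately have "card C = card (UNIV :: bit set) ^ C.dim"
    using C.card_carrier_eq_power_dim by (simp only: V.carrier_vs_is_self partial_object.simps simp_thms)
  then have "(2::nat) ^ C.dim = 2 ^ k" unfolding assms(3) card_bit ..
  then show ?thesis by (rule power_inject_exp[THEN iffD1, rotated]) simp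
qed

definition bit_sign :: "bit \<Rightarrow> int" where
  "bit_sign b = (if b = 0 then 1 else - 1)"

text \<open>Orthogonality of characters: if \<open>f\<close> is not zero, translation by some \<open>v\<close> with \<open>f v = 1\<close> reverses every
sign.\<close>

lemma sum_bit_sign_additive:
  assumes "finite W" and closed: "\<And>u v. u \<in> W \<Longrightarrow> v \<in> W \<Longrightarrow> u + v \<in> W"
    and cancel: "\<And>u v. u \<in> W \<Longrightarrow> v \<in> W \<Longrightarrow> u + v + v = u"
    and hom: "\<And>u v. u \<in> W \<Longrightarrow> v \<in> W \<Longrightarrow> f (u + v) = f u + f v"
  shows "(\<Sum>w\<in>W. bit_sign (f w)) = (if \<forall>w\<in>W. f w = 0 then int (card W) else 0)"
proof (cases "\<forall>w\<in>W. f w = 0")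
  case True
  then show ?thesis by (simp add: bit_sign_def)
next
  case False
  then obtain v where v: "v \<in> W" "f v = 1" by auto
  have "(\<Sum>w\<in>W. bit_sign (f w)) = (\<Sum>w\<in>W. bit_sign (f (w + v)))"
    by (rule sum.reindex_bij_witness[of _ "\<lambda>w. w + v" "\<lambda>w. w + v"])
      (use v(1) closed cancel in auto)
  also have "\<dots> = (\<Sum>w\<in>W. - bit_sign (f w))"
    by (rule sum.cong) (auto simp: hom v bit_sign_def)
  finally have "(\<Sum>w\<in>W. bit_sign (f w)) = 0" by (simp add: sum_negf)
  with False show ?thesis by (simp only: if_False)
qed

lemma bit_vec_add_cancel: "u + v + v = u"
  if "u \<in> carrier_vec n" "v \<in> carrier_vec n" for u v :: "bit vec"
proof (rule eq_vecI)
  fix i assume "i < dim_vec u"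
  then show "(u + v + v) $ i = u $ i"
    using that by (cases "v $ i") auto
qed (use that in auto)

lemma card_bit_carrier_vec: "card (carrier_vec n :: bit vec set) = 2 ^ n"
  and finite_bit_carrier_vec: "finite (carrier_vec n :: bit vec set)"
proof -
  have fin: "finite (UNIV :: bit set)" using card_bit by (simp add: card_ge_0_finite)
  have bij: "bij_betw vec_of_list {xs. set xs \<subseteq> UNIV \<and> length xs = n} (carrier_vec n :: bit vec set)"
    by (rule bij_betw_byWitness[where f' = list_of_vec]) (auto intro!: carrier_vecI simp: vec_list list_vec)
  moreover have "card {xs. set xs \<subseteq> (UNIV :: bit set) \<and> length xs = n} = 2 ^ n"
    "finite {xs. set xs \<subseteq> (UNIV :: bit set) \<and> length xs = n}"
    using card_lists_length_eq[of "UNIV :: bit set" n] finite_lists_length_eq[of "UNIV :: bit set" n] fin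
    by (simp_all only: card_bit)
  ultimately show "card (carrier_vec n :: bit vec set) = 2 ^ n" "finite (carrier_vec n :: bit vec set)"
    using bij_betw_same_card[OF bij] bij_betw_finite[OF bij] by simp_all
qed

lemma subspace_dual_code:
  assumes "C \<subseteq> carrier_vec n"
  shows "VectorSpace.subspace class_ring (dual_code n C) (module_vec TYPE(bit) n)"
  by (rule subspace_bit_vecI)
    (use assms in \<open>auto simp: dual_code_def add_scalar_prod_distrib[where n = n] subset_iff\<close>)

text \<open>Both sides are the sum of \<open>(-1) ^ (u \<bullet> c)\<close> over all \<open>u\<close> and all \<open>c \<in> C\<close>: summation over \<open>c\<close> leaves the \<open>u\<close> in the dual
code, summation over \<open>u\<close> leaves \<open>c = 0\<close>.\<close>

lemma card_dual_code:
  assumes C: "C \<subseteq> carrier_vec n" and zero: "0\<^sub>v n \<in> C"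
    and add: "\<And>u v. u \<in> C \<Longrightarrow> v \<in> C \<Longrightarrow> u + v \<in> C"
  shows "card C * card (dual_code n C) = 2 ^ n"
proof -
  let ?V = "carrier_vec n :: bit vec set"
  have fin: "finite ?V" "finite C" using finite_bit_carrier_vec C finite_subset by blast+
  have "(\<Sum>u\<in>?V. \<Sum>c\<in>C. bit_sign (u \<bullet> c))
      = (\<Sum>u\<in>?V. if \<forall>c\<in>C. u \<bullet> c = 0 then int (card C) else 0)"
  proof (rule sum.cong[OF refl], rule sum_bit_sign_additive[OF fin(2) add])
    fix u v w assume u: "u \<in> ?V" and "v \<in> C" "w \<in> C"
    then have vw: "v \<in> ?V" "w \<in> ?V" using C by auto
    show "v + w + w = v" using vw by (rule bit_vec_add_cancel)
    show "u \<bullet> (v + w) = u \<bullet> v + u \<bullet> w" using u vw by (rule scalar_prod_add_distrib)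
  qed
  also have "\<dots> = (\<Sum>u\<in>dual_code n C. int (card C))"
    unfolding dual_code_def by (rule sum.inter_filter[OF fin(1), symmetric])
  also have "\<dots> = int (card C * card (dual_code n C))" by simp
  finally have 1: "(\<Sum>u\<in>?V. \<Sum>c\<in>C. bit_sign (u \<bullet> c)) = int (card C * card (dual_code n C))" .
  have nondeg: "c = 0\<^sub>v n" if "c \<in> ?V" "\<forall>u\<in>?V. u \<bullet> c = 0" for c
  proof (rule eq_vecI)
    fix i assume "i < dim_vec (0\<^sub>v n :: bit vec)"
    then show "c $ i = 0\<^sub>v n $ i"
      using that(2)[rule_format, of "unit_vec n i"] that(1) by (simp add: scalar_prod_left_unit)
  qed (use that in auto)
  have "(\<Sum>u\<in>?V. \<Sum>c\<in>C. bit_sign (u \<bullet> c)) = (\<Sum>c\<in>C. \<Sum>u\<in>?V. bit_sign (u \<bullet> c))"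
    by (rule sum.swap)
  also have "\<dots> = (\<Sum>c\<in>C. if \<forall>u\<in>?V. u \<bullet> c = 0 then int (card ?V) else 0)"
  proof (rule sum.cong[OF refl], rule sum_bit_sign_additive[OF fin(1)])
    fix c u v assume "c \<in> C" and uv: "u \<in> ?V" "v \<in> ?V"
    then have c: "c \<in> ?V" using C by auto
    show "u + v \<in> ?V" using uv by (rule add_carrier_vec)
    show "u + v + v = u" using uv by (rule bit_vec_add_cancel)
    show "(u + v) \<bullet> c = u \<bullet> c + v \<bullet> c" using uv c by (rule add_scalar_prod_distrib)
  qed
  also have "\<dots> = (\<Sum>c\<in>C. if c = 0\<^sub>v n then int (card ?V) else 0)"
    using C nondeg by (intro sum.cong refl) (auto simp: subset_iff)
  also have "\<dots> = 2 ^ n" using zero fin by (simp add: card_bit_carrier_vec)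
  finally show ?thesis using 1 by (metis of_nat_eq_iff of_nat_numeral of_nat_power)
qed

section \<open>The trace code of a semibent set\<close>

locale large_odd_binary_field = odd_binary_field +
  assumes m_ge: "m \<ge> 5"
begin

abbreviation k :: nat where "k \<equiv> (m - 3) div 2"

lemma m_eq: "m = 2 * k + 3"
  using m_ge odd_m by presburger

lemma powers_m:
  "2 ^ m = (8 * (2 ^ k) ^ 2 :: 'b::comm_semiring_1)"
  "2 ^ (m - 1) = (4 * (2 ^ k) ^ 2 :: 'b::comm_semiring_1)"
  "2 ^ (m - 2) = (2 * (2 ^ k) ^ 2 :: 'b::comm_semiring_1)"
proof -
  define j where "j = k"
  have m: "m = Suc (Suc (Suc (2 * j)))" "m - 1 = Suc (Suc (2 * j))" "m - 2 = Suc (2 * j)"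
    using m_eq by (simp_all add: j_def)
  show "2 ^ m = (8 * (2 ^ k) ^ 2 :: 'b::comm_semiring_1)"
    "2 ^ (m - 1) = (4 * (2 ^ k) ^ 2 :: 'b::comm_semiring_1)"
    "2 ^ (m - 2) = (2 * (2 ^ k) ^ 2 :: 'b::comm_semiring_1)"
    unfolding m j_def[symmetric] by (simp_all add: power_mult mult.commute[of 2 j] flip: mult.assoc)
qed

abbreviation K :: nat where "K \<equiv> 2 ^ k"

lemma K_pos: "K \<ge> 2"
proof -
  have "k \<ge> 1" using m_ge by simp
  then have "2 ^ 1 \<le> K" by (intro power_increasing) auto
  then show ?thesis by simp
qed

lemma K_less: "2 * K ^ 2 > K"
  using K_pos by (simp add: power2_eq_square)

end

locale semibent_code = large_odd_binary_field m field_type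
  for m :: nat and field_type :: "'a::finite_field itself" +
  fixes D :: "'a set" and ds :: "'a list"
  assumes semibent: "semibent_set D"
    and distinct: "distinct ds" and set_ds: "set ds = D"
begin

abbreviation n :: nat where "n \<equiv> 2 ^ (m - 1)"

lemma length_ds: "length ds = n"
  using semibent distinct_card[OF distinct] by (simp add: set_ds semibent_set_def)

lemma zero_notin: "0 \<notin> D" and card_D: "card D = n"
  and walsh_square: "a \<noteq> 0 \<Longrightarrow> walsh D a ^ 2 \<in> {0, int n}"
  using semibent by (auto simp: semibent_set_def)

lemma finite_D [simp]: "finite D" using set_ds finite_set by metis

lemma walsh_0: "walsh D 0 = int n"
  by (simp add: walsh_def card_D)

lemma sum_walsh: "(\<Sum>a\<in>UNIV. walsh D a) = 0"
proof -
  have "(\<Sum>a\<in>UNIV. walsh D a) = (\<Sum>d\<in>D. \<Sum>a\<in>UNIV. chi (a * d))"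
    unfolding walsh_def by (rule sum.swap)
  also have "\<dots> = 0" using zero_notin by (intro sum.neutral) (auto simp: sum_chi_mult)
  finally show ?thesis .
qed

lemma sum_walsh_square: "(\<Sum>a\<in>UNIV. walsh D a ^ 2) = 2 ^ m * int n"
proof -
  have "(\<Sum>a\<in>UNIV. walsh D a ^ 2) = (\<Sum>a\<in>UNIV. \<Sum>d\<in>D. \<Sum>e\<in>D. chi (a * (d + e)))"
    by (simp add: walsh_def power2_eq_square sum_product chi_add distrib_left)
  also have "\<dots> = (\<Sum>d\<in>D. \<Sum>a\<in>UNIV. \<Sum>e\<in>D. chi (a * (d + e)))"
    by (rule sum.swap)
  also have "\<dots> = (\<Sum>d\<in>D. \<Sum>e\<in>D. \<Sum>a\<in>UNIV. chi (a * (d + e)))"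
    by (intro sum.cong refl sum.swap)
  also have "\<dots> = (\<Sum>d\<in>D. \<Sum>e\<in>D. if d = e then 2 ^ m else 0)"
    by (simp only: sum_chi_mult add_eq_zero_iff)
  also have "\<dots> = 2 ^ m * int n" by (simp add: card_D)
  finally show ?thesis .
qed

text \<open>The third moment of the character sums is \<open>q\<close> times the number of triples in \<open>D\<close> with sum \<open>0\<close>. As
\<open>W ^ 3 = n * W\<close> for \<open>a \<noteq> 0\<close>, it equals \<open>n ^ 3 - n\<^sup>2\<close>, which is positive.\<close>

lemma zero_sum_triple:
  "\<exists>d\<in>D. \<exists>e\<in>D. d + e \<in> D"
proof (rule ccontr)
  assume *: "\<not> (\<exists>d\<in>D. \<exists>e\<in>D. d + e \<in> D)"
  have none: "d + e + g \<noteq> 0" if "d \<in> D" "e \<in> D" "g \<in> D" for d e g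
    using that * by auto
  have "(\<Sum>a\<in>UNIV. walsh D a ^ 3)
      = (\<Sum>a\<in>UNIV. \<Sum>d\<in>D. \<Sum>e\<in>D. \<Sum>g\<in>D. chi (a * (d + e + g)))"
  proof (rule sum.cong[OF refl])
    fix a
    have "walsh D a * walsh D a = (\<Sum>d\<in>D. \<Sum>e\<in>D. chi (a * d) * chi (a * e))"
      by (simp only: walsh_def sum_product)
    then have "walsh D a ^ 3 = (\<Sum>d\<in>D. \<Sum>e\<in>D. chi (a * d) * chi (a * e)) * walsh D a"
      by (simp only: power3_eq_cube)
    also have "\<dots> = (\<Sum>d\<in>D. \<Sum>e\<in>D. chi (a * d) * chi (a * e) * walsh D a)"
      by (simp only: sum_distrib_right)
    finally have "walsh D a ^ 3 = (\<Sum>d\<in>D. \<Sum>e\<in>D. chi (a * d) * chi (a * e) * walsh D a)" .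
    then show "walsh D a ^ 3 = (\<Sum>d\<in>D. \<Sum>e\<in>D. \<Sum>g\<in>D. chi (a * (d + e + g)))"
      unfolding chi_add distrib_left
      by (simp only: sum_distrib_left[symmetric] walsh_def[symmetric])
  qed
  also have "\<dots> = (\<Sum>d\<in>D. \<Sum>a\<in>UNIV. \<Sum>e\<in>D. \<Sum>g\<in>D. chi (a * (d + e + g)))"
    by (rule sum.swap)
  also have "\<dots> = (\<Sum>d\<in>D. \<Sum>e\<in>D. \<Sum>a\<in>UNIV. \<Sum>g\<in>D. chi (a * (d + e + g)))"
    by (rule sum.cong[OF refl], rule sum.swap)
  also have "\<dots> = (\<Sum>d\<in>D. \<Sum>e\<in>D. \<Sum>g\<in>D. \<Sum>a\<in>UNIV. chi (a * (d + e + g)))"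
    by (rule sum.cong[OF refl], rule sum.cong[OF refl], rule sum.swap)
  also have "\<dots> = 0"
    by (rule sum.neutral, rule ballI, rule sum.neutral, rule ballI, rule sum.neutral, rule ballI)
      (simp only: sum_chi_mult none if_False)
  finally have "(\<Sum>a\<in>UNIV. walsh D a ^ 3) = 0" .
  moreover have "(\<Sum>a\<in>UNIV. walsh D a ^ 3) = int n ^ 3 - int n ^ 2"
  proof -
    have "(\<Sum>a\<in>UNIV. walsh D a ^ 3) = walsh D 0 ^ 3 + (\<Sum>a\<in>UNIV - {0}. walsh D a ^ 3)"
      by (rule sum.remove) auto
    also have "(\<Sum>a\<in>UNIV - {0}. walsh D a ^ 3) = (\<Sum>a\<in>UNIV - {0}. int n * walsh D a)"
    proof (rule sum.cong[OF refl])
      fix a :: 'a assume "a \<in> UNIV - {0}"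
      then have "walsh D a ^ 2 = 0 \<or> walsh D a ^ 2 = int n" using walsh_square by auto
      then have "walsh D a * walsh D a ^ 2 = int n * walsh D a" by auto
      then show "walsh D a ^ 3 = int n * walsh D a" by (simp add: eval_nat_numeral)
    qed
    also have "\<dots> = int n * (\<Sum>a\<in>UNIV - {0}. walsh D a)" by (simp add: sum_distrib_left)
    also have "(\<Sum>a\<in>UNIV - {0}. walsh D a) = - int n"
      using sum.remove[of UNIV "0::'a" "walsh D"] sum_walsh walsh_0 by simp
    finally show ?thesis by (simp add: walsh_0 power2_eq_square)
  qed
  ultimately have "int n ^ 2 * (int n - 1) = 0" by (simp add: algebra_simps eval_nat_numeral)
  then have "n = 1" by (auto simp: zero_power)
  then show False using m_ge by simp
qed

subsection \<open>The code\<close>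

definition cw :: "'a \<Rightarrow> bit vec" where
  "cw x = vec_of_list (map (\<lambda>d. Tr (x * d)) ds)"

lemma trace_code_eq: "trace_code m ds = range cw"
  by (simp add: trace_code_def cw_def)

lemma dim_cw [simp]: "dim_vec (cw x) = n" by (simp add: cw_def length_ds)

lemma cw_index: "i < n \<Longrightarrow> cw x $ i = Tr (x * ds ! i)"
  by (simp add: cw_def vec_of_list_index length_ds)

lemma cw_carrier: "cw x \<in> carrier_vec n" by (rule carrier_vecI) simp

lemma cw_add: "cw (x + y) = cw x + cw y"
  by (rule eq_vecI) (simp_all add: cw_index distrib_right)

lemma cw_0: "cw 0 = 0\<^sub>v n"
  by (rule eq_vecI) (simp_all add: cw_index)

lemma walsh_eq_weight: "walsh D x = int n - 2 * int (hamming_weight (cw x))"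
proof -
  have "walsh D x = (\<Sum>i<n. chi (x * ds ! i))"
    unfolding walsh_def set_ds[symmetric]
    using sum.reindex_bij_betw[OF bij_betw_nth[OF distinct refl refl], of "\<lambda>d. chi (x * d)"]
    by (simp add: length_ds lessThan_def)
  also have "\<dots> = (\<Sum>i<n. 1 - (if cw x $ i \<noteq> 0 then 2 else 0))"
    by (rule sum.cong) (auto simp: cw_index chi_def)
  also have "\<dots> = int n - (\<Sum>i\<in>{i\<in>{..<n}. cw x $ i \<noteq> 0}. 2)"
    by (simp only: sum_subtractf sum.inter_filter[OF finite_lessThan]) simp
  finally show ?thesis by (simp add: hamming_weight_def)
qed

definition wt :: "'a \<Rightarrow> nat" where "wt x = hamming_weight (cw x)"

lemma weight_cases:
  assumes "x \<noteq> 0"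
  shows "wt x \<in> {2 * (2 ^ k) ^ 2 - 2 ^ k, 2 * (2 ^ k) ^ 2, 2 * (2 ^ k) ^ 2 + 2 ^ k}"
proof -
  define K where "K = (2::nat) ^ k"
  have W: "walsh D x = 4 * int K ^ 2 - 2 * int (wt x)"
    unfolding walsh_eq_weight wt_def powers_m K_def by simp
  have "walsh D x ^ 2 = 0 \<or> walsh D x ^ 2 = (2 * int K) ^ 2"
    using walsh_square[OF assms] unfolding powers_m K_def by (auto simp: power_mult_distrib)
  then have "walsh D x = 0 \<or> walsh D x = 2 * int K \<or> walsh D x = - (2 * int K)"
    by (simp only: power2_eq_iff zero_eq_power2)
  moreover have "int K ^ 2 = int (K ^ 2)" by simp
  ultimately have "wt x = 2 * K ^ 2 \<or> wt x + K = 2 * K ^ 2 \<or> wt x = 2 * K ^ 2 + K"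
    using W by linarith
  then show ?thesis unfolding K_def[symmetric] by auto
qed

lemma wt_0: "wt 0 = 0"
  by (simp add: wt_def cw_0 hamming_weight_def)

lemma wt_eq_0_iff: "wt x = 0 \<longleftrightarrow> x = 0"
  using weight_cases[of x] K_less wt_0 by (cases "x = 0") auto

lemma cw_inj: "inj cw"
proof (rule injI)
  fix x y assume "cw x = cw y"
  then have "cw (x + y) = cw (y + y)" by (simp only: cw_add)
  then have "wt (x + y) = wt (y + y)" by (simp only: wt_def)
  then have "wt (x + y) = 0" by (simp add: wt_0)
  then show "x = y" by (simp add: wt_eq_0_iff)
qed

lemma card_code: "card (range cw) = 2 ^ m"
  using card_image[OF cw_inj] by (simp add: card_field)

lemma weights_distinct:
  "0 \<noteq> 2 * K ^ 2 - K" "2 * K ^ 2 - K \<noteq> 2 * K ^ 2" "2 * K ^ 2 - K \<noteq> 2 * K ^ 2 + K"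
  "2 * K ^ 2 \<noteq> 2 * K ^ 2 + K" "0 \<noteq> 2 * K ^ 2" "0 \<noteq> 2 * K ^ 2 + K"
  using K_less K_pos by linarith+

text \<open>The character sum is \<open>2 * K\<close>, \<open>0\<close> or \<open>- 2 * K\<close> according to the weight. The numbers of nonzero elements of each kind
are the solution of three linear equations: the first and second moment, and the total number of elements.\<close>

lemma card_weight:
  "card {x. wt x = 2 * K ^ 2 - K} = 2 * K ^ 2 - K"
  "card {x. wt x = 2 * K ^ 2} = 4 * K ^ 2 - 1"
  "card {x. wt x = 2 * K ^ 2 + K} = 2 * K ^ 2 + K"
proof -
  define A B C where "A = {x. wt x = 2 * K ^ 2 - K}" and "B = {x. wt x = 2 * K ^ 2}"
    and "C = {x. wt x = 2 * K ^ 2 + K}"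
  have UNIV: "UNIV = {0} \<union> (A \<union> (B \<union> C))"
    unfolding A_def B_def C_def using weight_cases by blast
  have fibres: "{x. wt x = i} \<inter> {x. wt x = j} = {}" if "i \<noteq> j" for i j
    using that by blast
  have AB: "A \<inter> B = {}" and AC: "A \<inter> C = {}" and BC: "B \<inter> C = {}"
    unfolding A_def B_def C_def by (rule fibres, rule weights_distinct)+
  have "0 \<notin> A" "0 \<notin> B" "0 \<notin> C"
    by (simp_all only: A_def B_def C_def mem_Collect_eq wt_0 weights_distinct not_False_eq_True)
  then have disj: "A \<inter> (B \<union> C) = {}" "B \<inter> C = {}" "{0} \<inter> (A \<union> (B \<union> C)) = {}"
    using AB AC BC by blast+
  have split: "(\<Sum>x\<in>UNIV. F x) = F 0 + ((\<Sum>x\<in>A. F x) + ((\<Sum>x\<in>B. F x) + (\<Sum>x\<in>C. F x)))"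
    for F :: "'a \<Rightarrow> int"
  proof -
    have "sum F ({0} \<union> (A \<union> (B \<union> C))) = sum F {0} + (sum F A + (sum F B + sum F C))"
      by (simp only: sum.union_disjoint[OF finite finite disj(1)]
          sum.union_disjoint[OF finite finite disj(2)] sum.union_disjoint[OF finite finite disj(3)])
    then show ?thesis unfolding UNIV[symmetric] by simp
  qed
  have W: "walsh D x = 4 * int K ^ 2 - 2 * int (wt x)" for x
    unfolding walsh_eq_weight wt_def powers_m by simp
  have walsh_A: "walsh D x = 2 * int K" if "x \<in> A" for x
    using that K_less by (simp add: W A_def of_nat_diff)
  have walsh_B: "walsh D x = 0" if "x \<in> B" for x
    using that by (simp add: W B_def)
  have walsh_C: "walsh D x = - (2 * int K)" if "x \<in> C" for x
    using that by (simp add: W C_def)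
  have walsh_zero: "walsh D 0 = 4 * int K ^ 2" by (simp add: W wt_0)
  have "4 * int K ^ 2 + 2 * int K * int (card A) - 2 * int K * int (card C) = 0"
    using sum_walsh unfolding split by (simp add: walsh_A walsh_B walsh_C walsh_zero algebra_simps)
  then have "2 * int K * (2 * int K + int (card A) - int (card C)) = 0"
    by (simp add: algebra_simps power2_eq_square)
  then have 1: "2 * int K + int (card A) = int (card C)" by simp
  have "(4 * int K ^ 2) ^ 2 + 4 * int K ^ 2 * (int (card A) + int (card C)) = 32 * int K ^ 4"
    using sum_walsh_square unfolding split powers_m
    by (simp add: walsh_A walsh_B walsh_C walsh_zero algebra_simps power_mult_distrib eval_nat_numeral)
  then have "4 * int K ^ 2 * (4 * int K ^ 2 - (int (card A) + int (card C))) = 0"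
    by (simp add: algebra_simps eval_nat_numeral)
  then have 2: "int (card A) + int (card C) = 4 * int K ^ 2" by simp
  have "int CARD('a) = 1 + (int (card A) + (int (card B) + int (card C)))"
    using split[of "\<lambda>_. 1"] by simp
  then have 3: "8 * int K ^ 2 = 1 + (int (card A) + (int (card B) + int (card C)))"
    unfolding card_field powers_m by simp
  have S: "int K ^ 2 = int (K ^ 2)" by simp
  show "card {x. wt x = 2 * K ^ 2 - K} = 2 * K ^ 2 - K"
    using 1 2 K_less unfolding A_def[symmetric] S by linarith
  show "card {x. wt x = 2 * K ^ 2} = 4 * K ^ 2 - 1"
    using 2 3 unfolding B_def[symmetric] S by linarith
  show "card {x. wt x = 2 * K ^ 2 + K} = 2 * K ^ 2 + K"
    using 1 2 unfolding C_def[symmetric] S by linarith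
qed

lemma linear_trace_code: "linear_code n m (2 * K ^ 2 - K) (range cw)"
  unfolding linear_code_def
proof (intro conjI ballI)
  show sub: "VectorSpace.subspace class_ring (range cw) (module_vec TYPE(bit) n)"
  proof (rule subspace_bit_vecI)
    show "range cw \<subseteq> carrier_vec n" using cw_carrier by blast
    show "0\<^sub>v n \<in> range cw" using cw_0 by (metis rangeI)
    fix u v assume "u \<in> range cw" "v \<in> range cw"
    then show "u + v \<in> range cw" by (auto simp flip: cw_add)
  qed
  show "vectorspace.dim class_ring (module_vec TYPE(bit) n\<lparr>carrier := range cw\<rparr>) = m"
    using sub cw_carrier card_code by (intro dim_eq_if_card_eq) auto
  have "card {x. wt x = 2 * K ^ 2 - K} \<noteq> 0" using card_weight(1) K_less by simp
  then have "{x. wt x = 2 * K ^ 2 - K} \<noteq> {}" by (metis card.empty)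
  then obtain x where x: "wt x = 2 * K ^ 2 - K" by blast
  then have "cw x \<noteq> 0\<^sub>v n" using K_less wt_0 by (auto simp: wt_def cw_0)
  then show "\<exists>c\<in>range cw - {0\<^sub>v n}. hamming_weight c = 2 * K ^ 2 - K"
    using x by (auto simp: wt_def)
  fix c assume "c \<in> range cw - {0\<^sub>v n}"
  then obtain x where "c = cw x" "x \<noteq> 0" using cw_0 by auto
  then show "2 * K ^ 2 - K \<le> hamming_weight c"
    using weight_cases[OF \<open>x \<noteq> 0\<close>] unfolding \<open>c = cw x\<close> wt_def
    by (elim insertE emptyE; simp only: order_refl diff_le_self trans_le_add1)
qed

lemma weight_enumerator_trace_code:
  "weight_enumerator n (range cw) = 1 + monom (int (2 * K ^ 2 - K)) (2 * K ^ 2 - K)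
     + monom (int (4 * K ^ 2 - 1)) (2 * K ^ 2) + monom (int (2 * K ^ 2 + K)) (2 * K ^ 2 + K)"
proof -
  have card: "card {c \<in> range cw. hamming_weight c = i} = card {x. wt x = i}" for i
  proof -
    have "{c \<in> range cw. hamming_weight c = i} = cw ` {x. wt x = i}" by (auto simp: wt_def)
    then show ?thesis using card_image[OF inj_on_subset[OF cw_inj subset_UNIV]] by simp
  qed
  let ?I = "{2 * K ^ 2 - K, 2 * K ^ 2, 2 * K ^ 2 + K}"
  have n: "n = 4 * K ^ 2" by (rule powers_m)
  have "card {x. wt x = i} = 0" if "i \<in> {1..n} - ?I" for i
  proof -
    have "wt x \<noteq> i" for x using that weight_cases[of x] wt_0 by (cases "x = 0") auto
    then show ?thesis by simp
  qed
  moreover have "?I \<subseteq> {1..n}" unfolding n using K_less by simp linarith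
  ultimately have "(\<Sum>i=1..n. monom (int (card {x. wt x = i})) i)
      = (\<Sum>i\<in>?I. monom (int (card {x. wt x = i})) i)"
    by (intro sum.mono_neutral_right) simp_all
  also have "\<dots> = monom (int (2 * K ^ 2 - K)) (2 * K ^ 2 - K)
      + (monom (int (4 * K ^ 2 - 1)) (2 * K ^ 2) + monom (int (2 * K ^ 2 + K)) (2 * K ^ 2 + K))"
  proof -
    have "sum F {a, b, c} = F a + (F b + F c)" if "a \<noteq> b" "a \<noteq> c" "b \<noteq> c"
      for F :: "nat \<Rightarrow> int poly" and a b c
      using that by simp
    from this[OF weights_distinct(2-4)] show ?thesis by (simp only: card_weight)
  qed
  finally show ?thesis by (simp add: weight_enumerator_def card add.assoc)
qed

subsection \<open>The dual code\<close>

definition support :: "bit vec \<Rightarrow> nat set" where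
  "support u = {i. i < n \<and> u $ i \<noteq> 0}"

lemma finite_support [simp]: "finite (support u)" by (simp add: support_def)

lemma hamming_weight_support: "dim_vec u = n \<Longrightarrow> hamming_weight u = card (support u)"
  by (simp add: hamming_weight_def support_def)

lemma Tr_sum: "Tr (sum g A) = (\<Sum>i\<in>A. Tr (g i))"
  by (induction A rule: infinite_finite_induct) simp_all

text \<open>The columns of a generator matrix are the elements of \<open>D\<close>, and the trace form is nondegenerate.\<close>

lemma dual_iff_support_sum:
  assumes "u \<in> carrier_vec n"
  shows "u \<in> dual_code n (range cw) \<longleftrightarrow> (\<Sum>i\<in>support u. ds ! i) = 0"
proof -
  let ?s = "\<Sum>i\<in>support u. ds ! i"
  have prod: "u \<bullet> cw x = Tr (x * ?s)" for x
  proof -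
    have "u \<bullet> cw x = (\<Sum>i<n. u $ i * Tr (x * ds ! i))"
      by (simp add: scalar_prod_def cw_index lessThan_atLeast0)
    also have "\<dots> = (\<Sum>i\<in>support u. u $ i * Tr (x * ds ! i))"
      by (rule sum.mono_neutral_right) (auto simp: support_def)
    also have "\<dots> = (\<Sum>i\<in>support u. Tr (x * ds ! i))"
      by (rule sum.cong) (auto simp: support_def)
    also have "\<dots> = Tr (x * ?s)" by (simp add: Tr_sum sum_distrib_left)
    finally show ?thesis .
  qed
  have "(\<forall>x. Tr (x * ?s) = 0) \<longleftrightarrow> ?s = 0"
  proof
    assume *: "\<forall>x. Tr (x * ?s) = 0"
    show "?s = 0"
    proof (rule ccontr)
      assume "?s \<noteq> 0"
      then have "1 / ?s * ?s = 1" by simp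
      then show False using *[rule_format, of "1 / ?s"] by (simp only: Tr_1 one_neq_zero)
    qed
  qed simp
  then show ?thesis using assms by (simp add: dual_code_def prod)
qed

lemma ds_nth_in: "i < n \<Longrightarrow> ds ! i \<in> D"
  using set_ds length_ds nth_mem by metis

lemma ds_nth_eq: "i < n \<Longrightarrow> j < n \<Longrightarrow> ds ! i = ds ! j \<longleftrightarrow> i = j"
  using distinct length_ds by (simp add: nth_eq_iff_index_eq)

lemma dual_weight_ge:
  assumes "u \<in> dual_code n (range cw)" and "u \<noteq> 0\<^sub>v n"
  shows "3 \<le> hamming_weight u"
proof (rule ccontr)
  have u: "u \<in> carrier_vec n" using assms(1) by (simp add: dual_code_def)
  then have sum0: "(\<Sum>i\<in>support u. ds ! i) = 0" using dual_iff_support_sum assms(1) by blast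
  have "support u \<noteq> {}"
  proof
    assume "support u = {}"
    then have "u = 0\<^sub>v n" using u by (intro eq_vecI) (auto simp: support_def)
    then show False using assms(2) by contradiction
  qed
  moreover assume "\<not> 3 \<le> hamming_weight u"
  ultimately have "card (support u) = 1 \<or> card (support u) = 2"
  proof -
    assume "support u \<noteq> {}" "\<not> 3 \<le> hamming_weight u"
    then have "card (support u) \<noteq> 0" "card (support u) < 3"
      using u hamming_weight_support by auto
    then show ?thesis by linarith
  qed
  then show False
  proof
    assume "card (support u) = 1"
    then obtain i where i: "support u = {i}" by (auto simp: card_1_singleton_iff)
    then have "i < n" by (auto simp: support_def)
    then have "ds ! i \<in> D" by (rule ds_nth_in)
    then show False using sum0 i zero_notin by simp
  next
    assume "card (support u) = 2"
    then obtain i j where ij: "support u = {i, j}" "i \<noteq> j" by (auto simp: card_2_iff)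
    then have lt: "i < n" "j < n" by (auto simp: support_def)
    have "ds ! i = ds ! j" using sum0 ij by simp
    then show False using ds_nth_eq[OF lt] ij(2) by simp
  qed
qed

text \<open>Three elements of \<open>D\<close> with sum \<open>0\<close> are automatically distinct, since \<open>0 \<notin> D\<close>.\<close>

lemma dual_weight_3: "\<exists>u\<in>dual_code n (range cw) - {0\<^sub>v n}. hamming_weight u = 3"
proof -
  obtain d e where de: "d \<in> D" "e \<in> D" "d + e \<in> D" using zero_sum_triple by blast
  then obtain i j l where lt: "i < n" "j < n" "l < n" and nth: "ds ! i = d" "ds ! j = e" "ds ! l = d + e"
    unfolding set_ds[symmetric] in_set_conv_nth length_ds by blast
  have "d \<noteq> 0" "e \<noteq> 0" "d + e \<noteq> 0" using de zero_notin by metis+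
  then have "d \<noteq> e" "d \<noteq> d + e" "e \<noteq> d + e" by auto
  then have ne: "i \<noteq> j" "i \<noteq> l" "j \<noteq> l" using nth by auto
  define u :: "bit vec" where "u = vec n (\<lambda>h. if h \<in> {i, j, l} then 1 else 0)"
  have u: "u \<in> carrier_vec n" "dim_vec u = n" by (simp_all add: u_def)
  have supp: "support u = {i, j, l}" using lt by (auto simp: support_def u_def split: if_splits)
  have "(\<Sum>h\<in>support u. ds ! h) = 0" unfolding supp using ne by (simp add: nth two_eq_zero)
  then have "u \<in> dual_code n (range cw)" using dual_iff_support_sum[OF u(1)] by blast
  moreover have "hamming_weight u = 3"
    unfolding hamming_weight_support[OF u(2)] supp using ne by simp
  moreover have "u \<noteq> 0\<^sub>v n"
  proof
    assume "u = 0\<^sub>v n"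
    then have "u $ i = 0" using lt by simp
    then show False using lt by (simp add: u_def)
  qed
  ultimately show ?thesis by blast
qed

lemma linear_dual_code: "linear_code n (n - m) 3 (dual_code n (range cw))"
  unfolding linear_code_def
proof (intro conjI ballI)
  have C: "range cw \<subseteq> carrier_vec n" using cw_carrier by blast
  show sub: "VectorSpace.subspace class_ring (dual_code n (range cw)) (module_vec TYPE(bit) n)"
    using C by (rule subspace_dual_code)
  have "card (range cw) * card (dual_code n (range cw)) = 2 ^ n"
  proof (rule card_dual_code[OF C])
    show "0\<^sub>v n \<in> range cw" using cw_0 by (metis rangeI)
    fix u v assume "u \<in> range cw" "v \<in> range cw"
    then show "u + v \<in> range cw" by (auto simp flip: cw_add)
  qed
  moreover have "m \<le> n"
    using less_exp[of "m - 1"] m_ge by linarith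
  ultimately have "2 ^ m * card (dual_code n (range cw)) = 2 ^ m * 2 ^ (n - m)"
    unfolding card_code by (simp only: flip: power_add) simp
  then have "card (dual_code n (range cw)) = 2 ^ (n - m)" by simp
  then show "vectorspace.dim class_ring (module_vec TYPE(bit) n\<lparr>carrier := dual_code n (range cw)\<rparr>) = n - m"
    using sub by (intro dim_eq_if_card_eq) (auto simp: dual_code_def)
  show "\<exists>c\<in>dual_code n (range cw) - {0\<^sub>v n}. hamming_weight c = 3" by (rule dual_weight_3)
  show "3 \<le> hamming_weight c" if "c \<in> dual_code n (range cw) - {0\<^sub>v n}" for c
    using that dual_weight_ge by blast
qed

theorem code_parameters:
  "linear_code (2 ^ (m - 1)) m (2 ^ (m - 2) - 2 ^ ((m - 3) div 2)) (trace_code m ds) \<and>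
    weight_enumerator (2 ^ (m - 1)) (trace_code m ds) =
      1 + monom (2 ^ (m - 2) - 2 ^ ((m - 3) div 2)) (2 ^ (m - 2) - 2 ^ ((m - 3) div 2))
        + monom (2 ^ (m - 1) - 1) (2 ^ (m - 2))
        + monom (2 ^ (m - 2) + 2 ^ ((m - 3) div 2)) (2 ^ (m - 2) + 2 ^ ((m - 3) div 2)) \<and>
    linear_code (2 ^ (m - 1)) (2 ^ (m - 1) - m) 3 (dual_code (2 ^ (m - 1)) (trace_code m ds))"
proof -
  have coeffs: "int (2 * K ^ 2 - K) = 2 ^ (m - 2) - 2 ^ k" "int (4 * K ^ 2 - 1) = 2 ^ (m - 1) - 1"
    "int (2 * K ^ 2 + K) = 2 ^ (m - 2) + 2 ^ k"
    unfolding powers_m using K_less by (simp_all add: of_nat_diff)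
  show ?thesis
    using linear_trace_code linear_dual_code weight_enumerator_trace_code[unfolded coeffs]
    unfolding trace_code_eq powers_m(3)[where 'b = nat, symmetric] by blast
qed
end

section \<open>Reduction of the nine trinomials to three functions\<close>

context odd_binary_field begin

lemma powi_cong:
  assumes "x \<noteq> (0::'a)" and "i = j + (2 ^ m - 1) * t"
  shows "x powi i = x powi j"
proof -
  have "x powi (2 ^ m - 1) * x = x"
    using power_int_add_1[of x "2 ^ m - 1"] power_field_card[of x] assms(1)
      power_int_of_nat[of x "2 ^ m"] by simp
  then have "x powi (2 ^ m - 1) = 1" using assms(1) by simp
  then show ?thesis unfolding assms(2) using assms(1) by (simp add: power_int_add power_int_mult)
qed

lemma pow2_inj: "x ^ 2 ^ j = y ^ 2 ^ j \<Longrightarrow> x = (y::'a)"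
proof -
  assume "x ^ 2 ^ j = y ^ 2 ^ j"
  then have "(x + y) ^ 2 ^ j = 0" by (simp add: pow2_add)
  then show "x = y" by simp
qed

text \<open>As \<open>c\<close> is invertible modulo \<open>2 ^ m - 1\<close>, \<open>w \<mapsto> w ^ c\<close> permutes the nonzero elements; and a power of Frobenius is
injective. The Frobenius exponent \<open>j\<close> is \<open>0\<close>, \<open>1\<close> or \<open>2\<close> for the nine trinomials.\<close>

lemma image_substitution:
  fixes f base :: "'a \<Rightarrow> 'a" and c c' t :: int
  assumes inverse: "c * c' = 1 + (2 ^ m - 1) * t"
    and f: "\<And>w. w \<noteq> 0 \<Longrightarrow> f w ^ 2 ^ j = base (w powi c)"
    and base: "\<And>y. y \<in> D \<longleftrightarrow> (\<exists>x. x \<noteq> 0 \<and> base x = y ^ 2 ^ j)"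
  shows "f ` (- {0::'a}) = D"
proof
  show "f ` (- {0}) \<subseteq> D"
  proof (rule image_subsetI)
    fix w :: 'a assume "w \<in> - {0}"
    then have "w \<noteq> 0" by simp
    then show "f w \<in> D" unfolding base
      by (intro exI[of _ "w powi c"]) (simp add: f)
  qed
  show "D \<subseteq> f ` (- {0})"
  proof
    fix y assume "y \<in> D"
    then obtain x where x: "x \<noteq> 0" "base x = y ^ 2 ^ j" unfolding base by blast
    have "x powi (c' * c) = x powi 1"
      by (rule powi_cong[OF x(1), where t = t]) (simp only: mult.commute[of c' c] inverse)
    then have "(x powi c') powi c = x" by (simp only: power_int_mult power_int_1_right)
    moreover have nz: "x powi c' \<noteq> 0" using x(1) by simp
    ultimately have "f (x powi c') ^ 2 ^ j = y ^ 2 ^ j" using f[OF nz] x(2) by simp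
    then have "f (x powi c') = y" by (rule pow2_inj)
    then show "y \<in> f ` (- {0})" using nz by blast
  qed
qed

lemma nonzero_values_trinomial:
  assumes "a > 0" and "b > 0" and "(\<lambda>w. w ^ a + w ^ b + w) ` (- {0::'a}) = D" and "0 \<notin> D"
  shows "nonzero_values (monom 1 a + monom 1 b + monom 1 1) = D"
proof -
  let ?f = "\<lambda>w::'a. w ^ a + w ^ b + w"
  have "poly (monom 1 a + monom 1 b + monom 1 1) = ?f" by (rule ext) (simp add: poly_monom)
  moreover have "range ?f = insert (?f 0) (?f ` (- {0}))"
  proof -
    have "(UNIV :: 'a set) = insert 0 (- {0})" by blast
    then have "range ?f = ?f ` insert 0 (- {0})" by (rule arg_cong)
    then show ?thesis by (simp only: image_insert)
  qed
  moreover have "?f 0 = 0" using assms(1,2) by (simp add: zero_power)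
  ultimately show ?thesis unfolding nonzero_values_def assms(3) using assms(4) by simp
qed

lemma glynn_image_iff: "y \<in> {y. Tr (y ^ 3) = 1} \<longleftrightarrow> (\<exists>x. x \<noteq> 0 \<and> glynn x = y ^ 2 ^ 0)"
proof -
  have "Tr (y ^ 3) = 1 \<longleftrightarrow> (\<exists>x. x \<noteq> 0 \<and> glynn x = y)"
  proof
    assume "Tr (y ^ 3) = 1"
    then obtain x where "x \<noteq> 0" "glynn x = y" by (rule glynn_surj)
    then show "\<exists>x. x \<noteq> 0 \<and> glynn x = y" by blast
  next
    assume "\<exists>x. x \<noteq> 0 \<and> glynn x = y"
    then obtain x where x: "x \<noteq> 0" "y = glynn x" by blast
    show "Tr (y ^ 3) = 1" unfolding x(2) using x(1) by (rule Tr_cube_glynn)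
  qed
  then show ?thesis by simp
qed

lemma norm_fun_image_iff: "y \<in> {y. Tr (y * bar y) = 1} \<longleftrightarrow> (\<exists>x. x \<noteq> 0 \<and> norm_fun x = y ^ 2 ^ 1)"
proof -
  have Tr_eq: "Tr (y ^ 2 * bar (y ^ 2)) = Tr (y * bar y)"
    using Tr_square[of "y * bar y"] by (simp only: bar_power power_mult_distrib)
  have "Tr (y * bar y) = 1 \<longleftrightarrow> (\<exists>x. x \<noteq> 0 \<and> norm_fun x = y ^ 2)"
  proof
    assume "Tr (y * bar y) = 1"
    then obtain x where "x \<noteq> 0" "norm_fun x = y ^ 2" by (rule norm_fun_surj)
    then show "\<exists>x. x \<noteq> 0 \<and> norm_fun x = y ^ 2" by blast
  next
    assume "\<exists>x. x \<noteq> 0 \<and> norm_fun x = y ^ 2"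
    then obtain x where x: "x \<noteq> 0" "norm_fun x = y ^ 2" by blast
    show "Tr (y * bar y) = 1" using Tr_norm_fun[OF x(1)] unfolding x(2) Tr_eq .
  qed
  then show ?thesis by simp
qed

lemma segre_fun_frobenius: "segre_fun (x ^ 2 ^ j) = segre_fun x ^ 2 ^ j"
proof -
  have "segre_fun (x ^ 2 ^ j) = 1 / (x ^ 4) ^ 2 ^ j + (x ^ 6) ^ 2 ^ j + x ^ 2 ^ j"
    unfolding segre_fun_def by (simp add: mult.commute flip: power_mult)
  then show ?thesis by (simp add: segre_fun_def pow2_add power_divide)
qed

text \<open>The coefficients lie in the prime field, so the image is invariant under Frobenius.\<close>

lemma segre_fun_image_iff: "y \<in> segre_fun ` (- {0}) \<longleftrightarrow> (\<exists>x. x \<noteq> 0 \<and> segre_fun x = y ^ 2 ^ j)"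
proof
  assume "y \<in> segre_fun ` (- {0})"
  then obtain x where "x \<in> - {0}" "y = segre_fun x" by blast
  then show "\<exists>x. x \<noteq> 0 \<and> segre_fun x = y ^ 2 ^ j"
    by (intro exI[of _ "x ^ 2 ^ j"]) (simp add: segre_fun_frobenius)
next
  assume "\<exists>x. x \<noteq> 0 \<and> segre_fun x = y ^ 2 ^ j"
  then obtain x where x: "x \<noteq> 0" "segre_fun x = y ^ 2 ^ j" by blast
  have "inj (\<lambda>x::'a. x ^ 2 ^ j)" by (rule injI) (rule pow2_inj)
  then obtain u where u: "x = u ^ 2 ^ j" using inj_imp_surj surjD by metis
  then have "segre_fun u = y" using x(2) by (simp only: segre_fun_frobenius) (rule pow2_inj)
  moreover have "u \<noteq> 0" using u x(1) by auto
  ultimately show "y \<in> segre_fun ` (- {0})" by blast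
qed

end

context large_odd_binary_field begin

text \<open>With \<open>K = 2 ^ k\<close> one has \<open>\<sigma> = 4 * K\<close> and \<open>2 ^ m = 8 * K\<^sup>2\<close>. The exponents of the trinomials are polynomials in
\<open>K\<close>, which are compared as integers modulo \<open>8 * K\<^sup>2 - 1\<close>.\<close>

abbreviation L :: int where "L \<equiv> 2 ^ k"

lemma half_powers:
  "(m + 3) div 2 = k + 3" "(m + 1) div 2 = k + 2" "(m - 1) div 2 = k + 1"
  using m_eq by simp_all

lemma half_power_eqs:
  "(2::'b::comm_semiring_1) ^ ((m + 3) div 2) = 8 * 2 ^ k"
  "(2::'b) ^ ((m + 1) div 2) = 4 * 2 ^ k"
  "(2::'b) ^ ((m - 1) div 2) = 2 * 2 ^ k"
  unfolding half_powers by (simp_all add: power_add mult.commute)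

lemma K_square_ge: "2 * K \<le> K ^ 2"
  using K_pos by (simp add: power2_eq_square)

lemma bar_powi: "bar x = x powi (4 * L)"
  unfolding bar_def half_power_eqs(2) using power_int_of_nat[of x "4 * K"] by simp

lemma glynn_powi: "x \<noteq> 0 \<Longrightarrow> glynn (x powi c) = x powi (c * (- 2)) + x powi (c * (12 * L + 4)) + x powi c"
proof -
  assume x: "x \<noteq> 0"
  let ?z = "x powi c"
  have "?z powi (4 * L * 3 + 4) = ?z powi (4 * L * 3) * ?z powi 4"
    using x by (intro power_int_add) simp
  also have "\<dots> = bar ?z ^ 3 * ?z ^ 4"
    by (simp only: bar_powi power_int_mult power_int_numeral)
  finally have "bar ?z ^ 3 * ?z ^ 4 = ?z powi (12 * L + 4)" by simp
  moreover have "1 / ?z ^ 2 = ?z powi (- 2)"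
    by (simp add: power_int_minus inverse_eq_divide)
  ultimately show ?thesis by (simp only: glynn_def power_int_mult)
qed

lemma norm_fun_powi: "x \<noteq> 0 \<Longrightarrow> norm_fun (x powi c) = x powi (c * 2) + x powi (c * (- 8 * L)) + x powi (c * (2 - 4 * L))"
proof -
  assume x: "x \<noteq> 0"
  let ?z = "x powi c"
  have "1 / bar ?z ^ 2 = ?z powi (- 8 * L)"
  proof -
    have "?z powi (- 8 * L) = ?z powi (- (4 * L * 2))" by simp
    also have "\<dots> = inverse ((?z powi (4 * L)) powi 2)"
      by (simp only: power_int_minus power_int_mult)
    finally show ?thesis by (simp add: bar_powi inverse_eq_divide)
  qed
  moreover have "?z ^ 2 / bar ?z = ?z powi (2 - 4 * L)"
    using x by (simp add: bar_powi power_int_diff)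
  moreover have "?z ^ 2 = ?z powi 2" by simp
  ultimately show ?thesis by (simp only: norm_fun_def power_int_mult)
qed

lemma segre_fun_powi: "x \<noteq> 0 \<Longrightarrow> segre_fun (x powi c) = x powi (c * (- 4)) + x powi (c * 6) + x powi c"
  by (simp add: segre_fun_def power_int_mult power_int_minus inverse_eq_divide)

lemma frobenius_trinomial:
  "(w ^ a + w ^ b + w) ^ 2 ^ j = w ^ (2 ^ j * a) + w ^ (2 ^ j * b) + w ^ 2 ^ j" for w :: 'a
  by (simp add: pow2_add mult.commute flip: power_mult)

lemma semibent_of_glynn:
  fixes c c' t :: int
  assumes "a > 0" "b > 0" and "c * c' = 1 + (2 ^ m - 1) * t"
    and match: "\<And>w::'a. w \<noteq> 0 \<Longrightarrow> w ^ a + w ^ b + w = glynn (w powi c)"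
  shows "semibent_set (nonzero_values (monom (1::'a) a + monom 1 b + monom 1 1))"
proof -
  have "(\<lambda>w. w ^ a + w ^ b + w) ` (- {0::'a}) = {y. Tr (y ^ 3) = 1}"
    using assms(3) by (rule image_substitution[OF _ _ glynn_image_iff]) (simp add: match)
  then show ?thesis
    using nonzero_values_trinomial[OF assms(1,2)] semibent_cube by (simp add: zero_power)
qed

lemma semibent_of_norm_fun:
  fixes c c' t :: int
  assumes "a > 0" "b > 0" and "c * c' = 1 + (2 ^ m - 1) * t"
    and match: "\<And>w::'a. w \<noteq> 0 \<Longrightarrow> w ^ (2 * a) + w ^ (2 * b) + w ^ 2 = norm_fun (w powi c)"
  shows "semibent_set (nonzero_values (monom (1::'a) a + monom 1 b + monom 1 1))"
proof -
  have "(\<lambda>w. w ^ a + w ^ b + w) ` (- {0::'a}) = {y. Tr (y * bar y) = 1}"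
  proof (rule image_substitution[OF assms(3) _ norm_fun_image_iff])
    fix w :: 'a assume "w \<noteq> 0"
    then show "(w ^ a + w ^ b + w) ^ 2 ^ 1 = norm_fun (w powi c)"
      using frobenius_trinomial[of w a b 1] match[of w] by simp
  qed
  then show ?thesis
    using nonzero_values_trinomial[OF assms(1,2)] semibent_norm by simp
qed

lemma semibent_of_segre_fun:
  fixes c c' t :: int
  assumes "a > 0" "b > 0" and "c * c' = 1 + (2 ^ m - 1) * t"
    and match: "\<And>w::'a. w \<noteq> 0 \<Longrightarrow> w ^ (2 ^ j * a) + w ^ (2 ^ j * b) + w ^ 2 ^ j = segre_fun (w powi c)"
  shows "semibent_set (nonzero_values (monom (1::'a) a + monom 1 b + monom 1 1))"
proof -
  have "(\<lambda>w. w ^ a + w ^ b + w) ` (- {0::'a}) = segre_fun ` (- {0})"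
  proof (rule image_substitution[OF assms(3) _ segre_fun_image_iff])
    fix w :: 'a assume "w \<noteq> 0"
    then show "(w ^ a + w ^ b + w) ^ 2 ^ j = segre_fun (w powi c)"
      unfolding frobenius_trinomial by (rule match)
  qed
  moreover have "0 \<notin> segre_fun ` (- {0})" using semibent_segre_fun unfolding semibent_set_def by (rule conjunct1)
  ultimately show ?thesis
    using nonzero_values_trinomial[OF assms(1,2)] semibent_segre_fun by simp
qed

lemma power_match:
  assumes "w \<noteq> (0::'a)" and "int a = j + (8 * L ^ 2 - 1) * t"
  shows "w ^ a = w powi j"
proof -
  have "w powi int a = w powi j"
    by (rule powi_cong[OF assms(1)]) (simp only: assms(2) powers_m)
  then show ?thesis by (simp only: power_int_of_nat)
qed

text \<open>In this and the following lemmas \<open>c\<close> is the exponent of the substitution, \<open>c'\<close> is its inverse, and the integers \<open>t\<close> are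
the multiples of \<open>8 * K\<^sup>2 - 1\<close> by which exponents differ.\<close>

lemma semibent_glynn_c:
  "semibent_set (nonzero_values (monom (1::'a) (2 ^ m - 3)
     + monom 1 (2 ^ ((m + 3) div 2) + 2 ^ ((m + 1) div 2) + 4) + monom 1 1))"
  unfolding powers_m half_power_eqs
proof (rule semibent_of_glynn[where c = 1 and c' = 1 and t = 0])
  show "0 < 8 * K ^ 2 - 3" using K_square_ge K_pos by linarith
  fix w :: 'a assume w: "w \<noteq> 0"
  have "w ^ (8 * K ^ 2 - 3) = w powi (1 * (- 2))"
    using K_square_ge K_pos by (intro power_match[OF w, where t = 1]) (simp add: of_nat_diff)
  moreover have "w ^ (8 * K + 4 * K + 4) = w powi (1 * (12 * L + 4))"
    by (intro power_match[OF w, where t = 0]) simp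
  ultimately show "w ^ (8 * K ^ 2 - 3) + w ^ (8 * K + 4 * K + 4) + w = glynn (w powi 1)"
    unfolding glynn_powi[OF w, of 1] by (simp only: power_int_1_right)
qed simp_all

lemma semibent_glynn_g:
  "semibent_set (nonzero_values (monom (1::'a) (2 ^ m - 3 * (2 ^ ((m + 1) div 2) - 1))
     + monom 1 (2 ^ ((m + 1) div 2) + 2 ^ ((m - 1) div 2) - 2) + monom 1 1))"
  unfolding powers_m half_power_eqs
proof (rule semibent_of_glynn[where c = "6 * L - 2" and c' = "12 * L + 4" and t = 9])
  show "0 < 8 * K ^ 2 - 3 * (4 * K - 1)" "0 < 4 * K + 2 * K - 2" using K_square_ge K_pos by linarith+
  show "(6 * L - 2) * (12 * L + 4) = 1 + (2 ^ m - 1) * 9"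
    unfolding powers_m by (simp add: algebra_simps power2_eq_square)
  fix w :: 'a assume w: "w \<noteq> 0"
  define a where "a = 8 * K ^ 2 - 3 * (4 * K - 1)"
  have "a + 12 * K = 8 * K ^ 2 + 3" unfolding a_def using K_square_ge K_pos by linarith
  from arg_cong[OF this, of int] have "int a + 12 * L = 8 * L ^ 2 + 3"
    by (simp only: of_nat_add of_nat_mult of_nat_power of_nat_numeral)
  then have "w ^ a = w powi ((6 * L - 2) * (- 2))"
    by (intro power_match[OF w, where t = 1]) simp
  moreover have "w ^ (4 * K + 2 * K - 2) = w powi (6 * L - 2)"
    using K_pos by (intro power_match[OF w, where t = 0]) (simp add: of_nat_diff)
  moreover have "w ^ 1 = w powi ((6 * L - 2) * (12 * L + 4))"
    by (intro power_match[OF w, where t = "- 9"]) (simp add: algebra_simps power2_eq_square)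
  ultimately show "w ^ (8 * K ^ 2 - 3 * (4 * K - 1)) + w ^ (4 * K + 2 * K - 2) + w
      = glynn (w powi (6 * L - 2))"
    unfolding a_def[symmetric]
    by (simp only: glynn_powi[OF w] power_one_right add_ac)
qed

lemma semibent_glynn_j:
  "semibent_set (nonzero_values (monom (1::'a) (2 ^ m - 3 * (2 ^ ((m - 1) div 2) + 1))
     + monom 1 (2 ^ (m - 1) - 1) + monom 1 1))"
  unfolding powers_m half_power_eqs
proof (rule semibent_of_glynn[where c = "- 4 * L ^ 2" and c' = "- 2" and t = 1])
  show "0 < 8 * K ^ 2 - 3 * (2 * K + 1)" using K_square_ge K_pos by simp
  show "0 < 4 * K ^ 2 - 1" using K_square_ge K_pos by linarith
  show "- 4 * L ^ 2 * - 2 = 1 + (2 ^ m - 1) * 1" unfolding powers_m by simp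
  fix w :: 'a assume w: "w \<noteq> 0"
  define a where "a = 8 * K ^ 2 - 3 * (2 * K + 1)"
  have "a + 6 * K + 3 = 8 * K ^ 2" unfolding a_def using K_square_ge K_pos by simp
  from arg_cong[OF this, of int] have "int a + 6 * L + 3 = 8 * L ^ 2"
    by (simp only: of_nat_add of_nat_mult of_nat_power of_nat_numeral)
  then have "w ^ a = w powi (- 4 * L ^ 2 * (12 * L + 4))"
    by (intro power_match[OF w, where t = "6 * L + 3"]) (simp add: algebra_simps power2_eq_square)
  moreover have "w ^ (4 * K ^ 2 - 1) = w powi (- 4 * L ^ 2)"
    using K_pos by (intro power_match[OF w, where t = 1]) (simp add: of_nat_diff)
  moreover have "w ^ 1 = w powi (- 4 * L ^ 2 * (- 2))"
    by (intro power_match[OF w, where t = "- 1"]) simp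
  ultimately show "w ^ (8 * K ^ 2 - 3 * (2 * K + 1)) + w ^ (4 * K ^ 2 - 1) + w = glynn (w powi (- 4 * L ^ 2))"
    unfolding a_def[symmetric]
    by (simp only: glynn_powi[OF w] power_one_right add_ac)
qed

lemma semibent_norm_fun_f:
  "semibent_set (nonzero_values (monom (1::'a) (2 ^ m - 2 ^ ((m + 1) div 2) + 2 ^ ((m - 1) div 2))
     + monom 1 (2 ^ m - 2 ^ ((m + 1) div 2) - 1) + monom 1 1))"
  unfolding powers_m half_power_eqs
proof (rule semibent_of_norm_fun[where c = 1 and c' = 1 and t = 0])
  show "0 < 8 * K ^ 2 - 4 * K + 2 * K" "0 < 8 * K ^ 2 - 4 * K - 1"
    using K_square_ge K_pos by linarith+
  fix w :: 'a assume w: "w \<noteq> 0"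
  have "w ^ (2 * (8 * K ^ 2 - 4 * K + 2 * K)) = w powi (1 * (2 - 4 * L))"
    using K_square_ge K_pos by (intro power_match[OF w, where t = 2]) (simp add: of_nat_diff)
  moreover have "w ^ (2 * (8 * K ^ 2 - 4 * K - 1)) = w powi (1 * (- 8 * L))"
    using K_square_ge K_pos by (intro power_match[OF w, where t = 2]) (simp add: of_nat_diff)
  moreover have "w ^ 2 = w powi (1 * 2)" by simp
  ultimately show "w ^ (2 * (8 * K ^ 2 - 4 * K + 2 * K)) + w ^ (2 * (8 * K ^ 2 - 4 * K - 1)) + w ^ 2
      = norm_fun (w powi 1)"
    by (simp only: norm_fun_powi[OF w] add_ac)
qed simp

lemma semibent_norm_fun_d:
  "semibent_set (nonzero_values (monom (1::'a) (2 ^ m - 2 ^ ((m - 1) div 2) - 1)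
     + monom 1 (2 ^ (m - 1) - 2 ^ ((m - 1) div 2)) + monom 1 1))"
  unfolding powers_m half_power_eqs
proof (rule semibent_of_norm_fun[where c = "- 2 * L" and c' = "- 4 * L" and t = 1])
  show "0 < 8 * K ^ 2 - 2 * K - 1" "0 < 4 * K ^ 2 - 2 * K" using K_square_ge K_pos by linarith+
  show "- 2 * L * (- 4 * L) = 1 + (2 ^ m - 1) * 1" unfolding powers_m by (simp add: power2_eq_square)
  fix w :: 'a assume w: "w \<noteq> 0"
  have "w ^ (2 * (8 * K ^ 2 - 2 * K - 1)) = w powi (- 2 * L * 2)"
    using K_square_ge K_pos by (intro power_match[OF w, where t = 2]) (simp add: of_nat_diff)
  moreover have "w ^ (2 * (4 * K ^ 2 - 2 * K)) = w powi (- 2 * L * (2 - 4 * L))"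
    using K_square_ge K_pos by (intro power_match[OF w, where t = 0])
      (simp add: of_nat_diff algebra_simps power2_eq_square)
  moreover have "w ^ 2 = w powi (- 2 * L * (- 8 * L))"
    by (intro power_match[OF w, where t = "- 2"]) (simp add: algebra_simps power2_eq_square)
  ultimately show "w ^ (2 * (8 * K ^ 2 - 2 * K - 1)) + w ^ (2 * (4 * K ^ 2 - 2 * K)) + w ^ 2
      = norm_fun (w powi (- 2 * L))"
    by (simp only: norm_fun_powi[OF w] add_ac)
qed

lemma semibent_norm_fun_i:
  "semibent_set (nonzero_values (monom (1::'a) (2 ^ m - 2 ^ ((m + 3) div 2) - 3)
     + monom 1 (2 ^ ((m + 1) div 2) + 2) + monom 1 1))"
  unfolding powers_m half_power_eqs
proof (rule semibent_of_norm_fun[where c = "4 * L + 2" and c' = "1 - 2 * L" and t = "- 1"])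
  show "0 < 8 * K ^ 2 - 8 * K - 3" using K_square_ge K_pos by linarith
  show "(4 * L + 2) * (1 - 2 * L) = 1 + (2 ^ m - 1) * - 1"
    unfolding powers_m by (simp add: algebra_simps power2_eq_square)
  fix w :: 'a assume w: "w \<noteq> 0"
  define a where "a = 8 * K ^ 2 - 8 * K - 3"
  have "a + 8 * K + 3 = 8 * K ^ 2" unfolding a_def using K_square_ge K_pos by linarith
  from arg_cong[OF this, of int] have "int a + 8 * L + 3 = 8 * L ^ 2"
    by (simp only: of_nat_add of_nat_mult of_nat_power of_nat_numeral)
  then have "w ^ (2 * a) = w powi ((4 * L + 2) * (- 8 * L))"
    by (intro power_match[OF w, where t = 6]) (simp add: algebra_simps power2_eq_square)
  moreover have "w ^ (2 * (4 * K + 2)) = w powi ((4 * L + 2) * 2)"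
    by (intro power_match[OF w, where t = 0]) simp
  moreover have "w ^ 2 = w powi ((4 * L + 2) * (2 - 4 * L))"
    by (intro power_match[OF w, where t = 2]) (simp add: algebra_simps power2_eq_square)
  ultimately show "w ^ (2 * (8 * K ^ 2 - 8 * K - 3)) + w ^ (2 * (4 * K + 2)) + w ^ 2
      = norm_fun (w powi (4 * L + 2))"
    unfolding a_def[symmetric]
    by (simp only: norm_fun_powi[OF w] add_ac)
qed simp

lemma semibent_segre_fun_k:
  "semibent_set (nonzero_values (monom (1::'a) (2 ^ m - 5) + monom 1 6 + monom 1 1))"
  unfolding powers_m
proof (rule semibent_of_segre_fun[where j = 0 and c = 1 and c' = 1 and t = 0])
  show "0 < 8 * K ^ 2 - 5" using K_square_ge K_pos by linarith
  fix w :: 'a assume w: "w \<noteq> 0"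
  have "w ^ (8 * K ^ 2 - 5) = w powi (1 * (- 4))"
    using K_square_ge K_pos by (intro power_match[OF w, where t = 1]) (simp add: of_nat_diff)
  then show "w ^ (2 ^ 0 * (8 * K ^ 2 - 5)) + w ^ (2 ^ 0 * 6) + w ^ 2 ^ 0 = segre_fun (w powi 1)"
    by (simp only: segre_fun_powi[OF w]) simp
qed simp_all

lemma semibent_segre_fun_h:
  "semibent_set (nonzero_values (monom (1::'a) (2 ^ m - 2 ^ (m - 2) - 1)
     + monom 1 (2 ^ (m - 1) - 2) + monom 1 1))"
  unfolding powers_m
proof (rule semibent_of_segre_fun[where j = 2 and c = "- 1" and c' = "- 1" and t = 0])
  show "0 < 8 * K ^ 2 - 2 * K ^ 2 - 1" "0 < 4 * K ^ 2 - 2" using K_square_ge K_pos by linarith+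
  fix w :: 'a assume w: "w \<noteq> 0"
  have "w ^ (2 ^ 2 * (8 * K ^ 2 - 2 * K ^ 2 - 1)) = w powi (- 1)"
    using K_square_ge K_pos by (intro power_match[OF w, where t = 3]) (simp add: of_nat_diff)
  moreover have "w ^ (2 ^ 2 * (4 * K ^ 2 - 2)) = w powi (- 1 * 6)"
    using K_square_ge K_pos by (intro power_match[OF w, where t = 2]) (simp add: of_nat_diff)
  moreover have "w ^ 2 ^ 2 = w powi (- 1 * (- 4))" by simp
  ultimately show "w ^ (2 ^ 2 * (8 * K ^ 2 - 2 * K ^ 2 - 1)) + w ^ (2 ^ 2 * (4 * K ^ 2 - 2)) + w ^ 2 ^ 2
      = segre_fun (w powi (- 1))"
    by (simp only: segre_fun_powi[OF w] add_ac)
qed simp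

text \<open>Writing \<open>K\<^sup>2 = 3 * d + 1\<close>, the first exponent is \<open>20 * d + 6\<close>. Modulo \<open>2 ^ m - 1 = 24 * d + 7\<close> it is the inverse of
\<open>6\<close>, so the substitution \<open>w = x ^ 6\<close> turns the trinomial into \<open>segre_fun x\<close>.\<close>

lemma semibent_segre_fun_e:
  "semibent_set (nonzero_values (monom (1::'a) (2 ^ m - 2 - (2 ^ (m - 1) - 2 ^ 2) div 3)
     + monom 1 (2 ^ m - 2 ^ 2 - (2 ^ m - 2 ^ 3) div 3) + monom 1 1))"
proof -
  have "3 dvd K ^ 2 - 1"
  proof -
    have "K ^ 2 = 4 ^ k" by (simp add: power2_eq_square flip: power_mult_distrib)
    moreover have "4 ^ k mod 3 = (1::nat)" using power_mod[of 4 "3::nat" k] by simp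
    ultimately have "K ^ 2 mod 3 = 1" by simp
    then show ?thesis by (metis dvd_minus_mod)
  qed
  then obtain d where "K ^ 2 - 1 = 3 * d" by (rule dvdE)
  then have d: "K ^ 2 = 3 * d + 1" using K_pos K_square_ge by linarith
  have dL: "L ^ 2 = 3 * int d + 1"
    using arg_cong[OF d, of int] by simp
  have e: "8 * K ^ 2 - 2 - (4 * K ^ 2 - 2 ^ 2) div 3 = 20 * d + 6"
    "8 * K ^ 2 - 2 ^ 2 - (8 * K ^ 2 - 2 ^ 3) div 3 = 16 * d + 4"
    unfolding d by simp_all
  show ?thesis
    unfolding powers_m e
  proof (rule semibent_of_segre_fun[where j = 0 and c = "20 * int d + 6" and c' = 6 and t = 5])
    show "(20 * int d + 6) * 6 = 1 + (2 ^ m - 1) * 5" unfolding powers_m dL by simp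
    fix w :: 'a assume w: "w \<noteq> 0"
    have "w ^ (20 * d + 6) = w powi (20 * int d + 6)"
      by (intro power_match[OF w, where t = 0]) simp
    moreover have "w ^ (16 * d + 4) = w powi ((20 * int d + 6) * (- 4))"
      by (intro power_match[OF w, where t = 4]) (simp add: dL)
    moreover have "w ^ 1 = w powi ((20 * int d + 6) * 6)"
      by (intro power_match[OF w, where t = "- 5"]) (simp add: dL)
    ultimately show "w ^ (2 ^ 0 * (20 * d + 6)) + w ^ (2 ^ 0 * (16 * d + 4)) + w ^ 2 ^ 0
        = segre_fun (w powi (20 * int d + 6))"
      by (simp only: segre_fun_powi[OF w] add_ac power_0 mult_1_left)
  qed simp_all
qed

end

theorem theorem46:
  fixes m :: nat
    and f :: "'a::finite_field poly"
    and ds :: "'a list"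
  assumes "CARD('a) = 2 ^ m"
    and "m \<ge> 5" and "odd m"
    and "f \<in> {
      monom 1 (2 ^ m - 3) + monom 1 (2 ^ ((m + 3) div 2) + 2 ^ ((m + 1) div 2) + 4) + monom 1 1,
      monom 1 (2 ^ m - 2 ^ ((m - 1) div 2) - 1) + monom 1 (2 ^ (m - 1) - 2 ^ ((m - 1) div 2)) + monom 1 1,
      monom 1 (2 ^ m - 2 - (2 ^ (m - 1) - 2 ^ 2) div 3) + monom 1 (2 ^ m - 2 ^ 2 - (2 ^ m - 2 ^ 3) div 3) + monom 1 1,
      monom 1 (2 ^ m - 2 ^ ((m + 1) div 2) + 2 ^ ((m - 1) div 2)) + monom 1 (2 ^ m - 2 ^ ((m + 1) div 2) - 1) + monom 1 1,
      monom 1 (2 ^ m - 3 * (2 ^ ((m + 1) div 2) - 1)) + monom 1 (2 ^ ((m + 1) div 2) + 2 ^ ((m - 1) div 2) - 2) + monom 1 1,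
      monom 1 (2 ^ m - 2 ^ (m - 2) - 1) + monom 1 (2 ^ (m - 1) - 2) + monom 1 1,
      monom 1 (2 ^ m - 2 ^ ((m + 3) div 2) - 3) + monom 1 (2 ^ ((m + 1) div 2) + 2) + monom 1 1,
      monom 1 (2 ^ m - 3 * (2 ^ ((m - 1) div 2) + 1)) + monom 1 (2 ^ (m - 1) - 1) + monom 1 1,
      monom 1 (2 ^ m - 5) + monom 1 6 + monom 1 1}"
    and "distinct ds" and "set ds = nonzero_values f"
  shows "linear_code (2 ^ (m - 1)) m (2 ^ (m - 2) - 2 ^ ((m - 3) div 2)) (trace_code m ds) \<and>
    weight_enumerator (2 ^ (m - 1)) (trace_code m ds) =
      1 + monom (2 ^ (m - 2) - 2 ^ ((m - 3) div 2)) (2 ^ (m - 2) - 2 ^ ((m - 3) div 2))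
        + monom (2 ^ (m - 1) - 1) (2 ^ (m - 2))
        + monom (2 ^ (m - 2) + 2 ^ ((m - 3) div 2)) (2 ^ (m - 2) + 2 ^ ((m - 3) div 2)) \<and>
    linear_code (2 ^ (m - 1)) (2 ^ (m - 1) - m) 3 (dual_code (2 ^ (m - 1)) (trace_code m ds))"
proof -
  interpret large_odd_binary_field m "TYPE('a)"
    using assms(1-3) by unfold_locales
  have "semibent_set (nonzero_values f)"
    using assms(4) semibent_glynn_c semibent_norm_fun_d semibent_segre_fun_e semibent_norm_fun_f semibent_glynn_g semibent_segre_fun_h
      semibent_norm_fun_i semibent_glynn_j semibent_segre_fun_k
    by (elim insertE emptyE) (simp_all only:)
  then interpret semibent_code m "TYPE('a)" "nonzero_values f" ds
    using assms(5,6) by unfold_locales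
  show ?thesis by (rule code_parameters)
qed

end
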